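(* There exist integer matrices $A$ and $B$ with the same number of columns such that $\mathrm{UGB}(A)=\mathcal G(A)$ (and hence $u(A,B)=g(A,B)$), but $\mathrm{UGB}([A,B]^{(N)})\subsetneq\mathcal G([A,B]^{(N)})$ for all integers $N>1$. One such example is $A=(1,1,1,1,1,1)$ and $B=(1,2,3,4,5,6)$.
   Context: Let $k$ be a field and $M\in\mathbb Z^{d\times n}$. Write $\mathbf u\in\mathbb Z^n$ as $\mathbf u=\mathbf u^+-\mathbf u^-$ with $\mathbf u^+,\mathbf u^-$ nonnegative of disjoint support. The toric ideal of $M$ is $I_M=\langle \mathbf x^{\mathbf u^+}-\mathbf x^{\mathbf u^-} : \mathbf u\in\mathbb Z^n,\ M\mathbf u=0\rangle\subseteq k[x_1,\ldots,x_n]$. Binomials $\mathbf x^{\mathbf u^+}-\mathbf x^{\mathbf u^-}$ are identified with vectors $\mathbf u\in\ker_{\mathbb Z}M$, considered up to sign. $\mathrm{UGB}(M)$, the universal Gröbner basis, is the union of all the (finitely many) reduced Gröbner bases of $I_M$. The Graver basis $\mathcal G(M)$ is the set of all nonzero binomials $\mathbf x^{\mathbf u^+}-\mathbf x^{\mathbf u^-}\in I_M$ for which there is no other nonzero binomial $\mathbf x^{\mathbf v^+}-\mathbf x^{\mathbf v^-}\in I_M$ such that $\mathbf x^{\mathbf v^+}$ divides $\mathbf x^{\mathbf u^+}$ and $\mathbf x^{\mathbf v^-}$ divides $\mathbf x^{\mathbf u^-}$. One always has $\mathrm{UGB}(M)\subseteq\mathcal G(M)$. For integer matrices $A,B$ with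 the same number of columns and $N\ge1$, the $N$-fold matrix is $$[A,B]^{(N)}=\begin{pmatrix} B&B&\cdots&B\\ A&0&&0\\ 0&A&&0\\ &&\ddots&\\ 0&0&&A\end{pmatrix}$$ with $N$ block columns. The type of $\mathbf u=(\mathbf u^{(1)},\ldots,\mathbf u^{(N)})\in\ker([A,B]^{(N)})$ is the number of indices $i$ with $\mathbf u^{(i)}\ne0$. The Graver complexity $g(A,B)$ (respectively, the Gröbner complexity $u(A,B)$) is the maximum type of an element of $\mathcal G([A,B]^{(N)})$ (respectively, of $\mathrm{UGB}([A,B]^{(N)})$) over all $N\ge 1$; these maxima are finite. *)

theory Defs
  imports
    "HOL-Library.Poly_Mapping"
    "HOL-Library.Extended_Nat"
    "Jordan_Normal_Form.Matrix_Kernel"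
begin

section \<open>The polynomial ring in \<open>n\<close> variables\<close>

text \<open>
  A monomial is its exponent vector. Monomials and polynomials live in types with countably many
  variables; \<open>monomials n\<close> and \<open>polys n\<close> carve out those in the variables with index below \<open>n\<close>.
\<close>

type_synonym mono = "nat \<Rightarrow>\<^sub>0 nat"
type_synonym 'k mpoly = "mono \<Rightarrow>\<^sub>0 'k"

definition monomials :: "nat \<Rightarrow> mono set" where
  "monomials n = {s. Poly_Mapping.keys s \<subseteq> {..<n}}"

definition polys :: "nat \<Rightarrow> 'k::field mpoly set" where
  "polys n = {p. Poly_Mapping.keys p \<subseteq> monomials n}"

definition mono_poly :: "mono \<Rightarrow> 'k::field mpoly" where
  "mono_poly s = Poly_Mapping.single s 1"

definition mono_dvd :: "mono \<Rightarrow> mono \<Rightarrow> bool" where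
  "mono_dvd s t \<longleftrightarrow> (\<exists>r. t = s + r)"

definition ideal_gen :: "nat \<Rightarrow> 'k::field mpoly set \<Rightarrow> 'k mpoly set" where
  "ideal_gen n S = {\<Sum>f\<in>F. c f * f | F c. finite F \<and> F \<subseteq> S \<and> (\<forall>f\<in>F. c f \<in> polys n)}"


section \<open>Reduced Groebner bases\<close>

definition term_order :: "nat \<Rightarrow> mono rel \<Rightarrow> bool" where
  "term_order n r \<longleftrightarrow>
     linear_order_on (monomials n) r \<and>
     (\<forall>s\<in>monomials n. (0, s) \<in> r) \<and>
     (\<forall>s t u. (s, t) \<in> r \<longrightarrow> u \<in> monomials n \<longrightarrow> (s + u, t + u) \<in> r)"

definition lead_mono :: "mono rel \<Rightarrow> 'k::field mpoly \<Rightarrow> mono" where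
  "lead_mono r p = (THE s. s \<in> Poly_Mapping.keys p \<and> (\<forall>t\<in>Poly_Mapping.keys p. (t, s) \<in> r))"

definition initial_ideal :: "nat \<Rightarrow> mono rel \<Rightarrow> 'k::field mpoly set \<Rightarrow> 'k mpoly set" where
  "initial_ideal n r I = ideal_gen n ((\<lambda>p. mono_poly (lead_mono r p)) ` (I - {0}))"

definition reduced_groebner_basis ::
  "nat \<Rightarrow> mono rel \<Rightarrow> 'k::field mpoly set \<Rightarrow> 'k mpoly set \<Rightarrow> bool" where
  "reduced_groebner_basis n r I G \<longleftrightarrow>
     finite G \<and> G \<subseteq> I \<and> 0 \<notin> G \<and>
     ideal_gen n ((\<lambda>g. mono_poly (lead_mono r g)) ` G) = initial_ideal n r I \<and>
     (\<forall>g\<in>G. Poly_Mapping.lookup g (lead_mono r g) = 1) \<and>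
     (\<forall>g\<in>G. \<forall>h\<in>G. h \<noteq> g \<longrightarrow> (\<forall>t\<in>Poly_Mapping.keys g. \<not> mono_dvd (lead_mono r h) t))"


section \<open>Toric ideals, universal Groebner bases and Graver bases\<close>

text \<open>The monomial with exponent vector \<open>u\<^sup>+\<close> (\<open>nat\<close> sends negative integers to \<open>0\<close>);
  that of \<open>u\<^sup>-\<close> is \<open>pos_mono (- u)\<close>.\<close>

definition pos_mono :: "int vec \<Rightarrow> mono" where
  "pos_mono u = (\<Sum>i<dim_vec u. Poly_Mapping.single i (nat (u $ i)))"

definition binom :: "int vec \<Rightarrow> 'k::field mpoly" where
  "binom u = mono_poly (pos_mono u) - mono_poly (pos_mono (- u))"

definition toric_ideal :: "int mat \<Rightarrow> 'k::field mpoly set" where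
  "toric_ideal M = ideal_gen (dim_col M) (binom ` mat_kernel M)"

definition UGB :: "int mat \<Rightarrow> 'k::field mpoly set" where
  "UGB M = \<Union> {G. \<exists>r. term_order (dim_col M) r \<and>
                      reduced_groebner_basis (dim_col M) r (toric_ideal M) G}"

definition graver :: "int mat \<Rightarrow> 'k::field mpoly set" where
  "graver M = {binom u | u. u \<in> carrier_vec (dim_col M) \<and>
     (binom u :: 'k mpoly) \<noteq> 0 \<and> (binom u :: 'k mpoly) \<in> toric_ideal M \<and>
     \<not> (\<exists>v \<in> carrier_vec (dim_col M). v \<noteq> u \<and>
          (binom v :: 'k mpoly) \<noteq> 0 \<and> (binom v :: 'k mpoly) \<in> toric_ideal M \<and>
          mono_dvd (pos_mono v) (pos_mono u) \<and> mono_dvd (pos_mono (- v)) (pos_mono (- u)))}"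

text \<open>
  Binomials are considered up to sign: elements of reduced Groebner bases are monic, whereas
  \<open>graver M\<close> contains both \<open>binom u\<close> and \<open>- binom u\<close>. Sets of polynomials are therefore
  compared after closing them under negation.
\<close>

definition up_to_sign :: "'k::field mpoly set \<Rightarrow> 'k mpoly set" where
  "up_to_sign S = S \<union> uminus ` S"


section \<open>N-fold matrices and complexities\<close>

text \<open>Column \<open>b * dim_col A + j\<close> is column \<open>j\<close> of block \<open>b\<close>.\<close>

definition nfold :: "int mat \<Rightarrow> int mat \<Rightarrow> nat \<Rightarrow> int mat" where
  "nfold A B N = mat (dim_row B + N * dim_row A) (N * dim_col A)
     (\<lambda>(i, j).
        if i < dim_row B then B $$ (i, j mod dim_col A)
        else if (i - dim_row B) div dim_row A = j div dim_col A
        then A $$ ((i - dim_row B) mod dim_row A, j mod dim_col A)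
        else 0)"

definition block_type :: "nat \<Rightarrow> nat \<Rightarrow> int vec \<Rightarrow> nat" where
  "block_type n N u = card {b. b < N \<and> (\<exists>j<n. u $ (b * n + j) \<noteq> 0)}"

text \<open>
  The maxima are suprema in \<^typ>\<open>enat\<close>, so that no junk value can arise from an unbounded set.
  The sign of \<open>u\<close> is irrelevant here, since the type of \<open>u\<close> is that of \<open>- u\<close>.
\<close>

definition max_type :: "(int mat \<Rightarrow> 'k::field mpoly set) \<Rightarrow> int mat \<Rightarrow> int mat \<Rightarrow> enat" where
  "max_type S A B = Sup {enat (block_type (dim_col A) N u) | N u.
     1 \<le> N \<and> u \<in> carrier_vec (N * dim_col A) \<and> binom u \<in> S (nfold A B N)}"

definition groebner_complexity :: "'k::field itself \<Rightarrow> int mat \<Rightarrow> int mat \<Rightarrow> enat" where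
  "groebner_complexity _ A B = max_type (UGB :: int mat \<Rightarrow> 'k mpoly set) A B"

definition graver_complexity :: "'k::field itself \<Rightarrow> int mat \<Rightarrow> int mat \<Rightarrow> enat" where
  "graver_complexity _ A B = max_type (graver :: int mat \<Rightarrow> 'k mpoly set) A B"

end

theory Submission
  imports Defs
begin

text \<open>
  Monomials are compared within the fibres of the matrix \<open>M\<close>, where two monomials lie in the same
  fibre if their exponent vectors have the same image under \<open>M\<close>. For a given term order, a monomial
  is standard if it is the smallest one of its fibre. The elements of the reduced Groebner basis of
  the toric ideal are the binomials \<open>x\<^sup>s - x\<^sup>t\<close> with \<open>s\<close> a minimal nonstandard monomial and \<open>t\<close> the
  standard monomial of its fibre (\<open>reduced_groebner_basis_element\<close>; existence rests on
  Dickson's lemma). From this description follow three facts on a vector \<open>u\<close> of the kernel.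

  \<^item> Elements of the universal Groebner basis are primitive, so \<open>UGB M \<subseteq> graver M\<close>
    (\<open>UGB_subset_graver\<close>).
  \<^item> If \<open>u\<close> is primitive and the monomials of the fibre of \<open>u\<^sup>+\<close> supported on \<open>u\<close> have exponents at
    most \<open>\<bar>u\<bar>\<close>, then a term order that penalises the other variables puts \<open>u\<close> into the
    universal Groebner basis, up to sign (\<open>primitive_vec_UGB\<close>).
  \<^item> If \<open>u\<^sup>+\<close> is the midpoint of two other nonconstant monomials of its fibre, then \<open>u\<close> is not in the
    universal Groebner basis (\<open>not_UGB_midpoint\<close>).

  Let \<open>A\<close> be a row of ones. Its primitive vectors are the differences of two unit vectors, and the
  second fact applies to them. The same fact applies to primitive vectors of an N-fold matrix for
  which \<open>u\<^sup>+\<close> has degree at most \<open>1\<close> in each block. Any other primitive vector is turned into one of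
  these, of larger type, by repeatedly splitting off a difference of two unit vectors into a new
  block (\<open>split_block\<close>); therefore the two complexities agree for every \<open>B\<close>. Finally, for
  \<open>B = (1, 2, 3, 4, 5, 6)\<close> and \<open>N \<ge> 2\<close> the vector with blocks
  \<open>(1, -1, 0, -1, 0, 1), (1, 0, 0, -2, 0, 1), 0, \<dots>, 0\<close> is primitive, while its \<open>u\<^sup>+\<close> is the
  midpoint of \<open>(2 e\<^sub>1, 2 e\<^sub>6)\<close> and \<open>(2 e\<^sub>6, 2 e\<^sub>1)\<close>.
\<close>


section \<open>Monomials and term orders\<close>

lemma mono_dvd_iff: "mono_dvd s t \<longleftrightarrow> (\<forall>i. Poly_Mapping.lookup s i \<le> Poly_Mapping.lookup t i)"
proof
  assume *: "\<forall>i. Poly_Mapping.lookup s i \<le> Poly_Mapping.lookup t i"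
  have "t = s + (t - s)"
    by (rule poly_mapping_eqI) (use * in \<open>simp add: lookup_add lookup_minus\<close>)
  then show "mono_dvd s t"
    unfolding mono_dvd_def by blast
qed (auto simp: mono_dvd_def lookup_add)

lemma mono_dvd_trans: "mono_dvd s t \<Longrightarrow> mono_dvd t u \<Longrightarrow> mono_dvd s u"
  unfolding mono_dvd_iff using order_trans by blast

lemma mono_dvd_antisym: "mono_dvd s t \<Longrightarrow> mono_dvd t s \<Longrightarrow> s = t"
  unfolding mono_dvd_iff by (intro poly_mapping_eqI) (simp add: order_antisym)

lemma keys_plus_nat: "Poly_Mapping.keys (s + t) = Poly_Mapping.keys s \<union> Poly_Mapping.keys t"
  for s t :: "'a \<Rightarrow>\<^sub>0 nat"
  by (auto simp: in_keys_iff lookup_add)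

lemma monomials_add_iff: "s + t \<in> monomials n \<longleftrightarrow> s \<in> monomials n \<and> t \<in> monomials n"
  by (simp add: monomials_def keys_plus_nat)

lemma zero_in_monomials: "0 \<in> monomials n"
  by (simp add: monomials_def)

lemma monomials_lookup: "s \<in> monomials n \<Longrightarrow> n \<le> i \<Longrightarrow> Poly_Mapping.lookup s i = 0"
  by (auto simp: monomials_def in_keys_iff)

lemma monomials_eqI:
  assumes "s \<in> monomials n" "t \<in> monomials n"
    and "\<And>i. i < n \<Longrightarrow> Poly_Mapping.lookup s i = Poly_Mapping.lookup t i"
  shows "s = t"
proof (rule poly_mapping_eqI)
  fix i show "Poly_Mapping.lookup s i = Poly_Mapping.lookup t i"
    using assms monomials_lookup by (cases "i < n") auto
qed

text \<open>Every sequence of naturals has a nondecreasing subsequence, so one can pass to subsequences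
  that are nondecreasing in one more coordinate at a time.\<close>

lemma nondecreasing_subseq:
  fixes f :: "nat \<Rightarrow> nat"
  shows "\<exists>g :: nat \<Rightarrow> nat. strict_mono g \<and> (\<forall>i j. i \<le> j \<longrightarrow> f (g i) \<le> f (g j))"
proof -
  obtain g :: "nat \<Rightarrow> nat" where g: "strict_mono g" "monoseq (\<lambda>k. f (g k))"
    using seq_monosub by blast
  show ?thesis
  proof (cases "\<forall>m. \<forall>k\<ge>m. f (g m) \<le> f (g k)")
    case True
    then show ?thesis using g by blast
  next
    case False
    then have dec: "i \<le> j \<Longrightarrow> f (g j) \<le> f (g i)" for i j
      using g(2) unfolding monoseq_def by blast
    define m where "m = (LEAST x. x \<in> range (\<lambda>k. f (g k)))"
    have "m \<in> range (\<lambda>k. f (g k))"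
      unfolding m_def by (rule LeastI_ex) blast
    then obtain k where k: "f (g k) = m" by auto
    have "f (g j) = m" if "k \<le> j" for j
      using dec[OF that] k Least_le[of "\<lambda>x. x \<in> range (\<lambda>k. f (g k))" "f (g j)"]
      by (simp add: m_def)
    then have "\<forall>i j. f (g (i + k)) \<le> f (g (j + k))" by simp
    moreover have "strict_mono (\<lambda>i. g (i + k))"
      using g(1) by (simp add: strict_mono_def)
    ultimately show ?thesis by blast
  qed
qed

lemma Dickson_subseq:
  fixes f :: "nat \<Rightarrow> nat \<Rightarrow> nat"
  shows "\<exists>g :: nat \<Rightarrow> nat. strict_mono g \<and> (\<forall>i<n. \<forall>j k. j \<le> k \<longrightarrow> f (g j) i \<le> f (g k) i)"
proof (induction n)
  case 0
  show ?case by (intro exI[of _ "\<lambda>k. k"]) (simp add: strict_mono_def)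
next
  case (Suc n)
  then obtain g :: "nat \<Rightarrow> nat" where g: "strict_mono g" "\<forall>i<n. \<forall>j k. j \<le> k \<longrightarrow> f (g j) i \<le> f (g k) i"
    by blast
  obtain h :: "nat \<Rightarrow> nat" where h: "strict_mono h" "\<forall>j k. j \<le> k \<longrightarrow> f (g (h j)) n \<le> f (g (h k)) n"
    using nondecreasing_subseq[of "\<lambda>k. f (g k) n"] by blast
  have "strict_mono (\<lambda>k. g (h k))"
    using g(1) h(1) by (simp add: strict_mono_def)
  moreover have "f (g (h j)) i \<le> f (g (h k)) i" if "i < Suc n" "j \<le> k" for i j k
    using that g(2) h strict_mono_less_eq[OF h(1)] by (cases "i = n") auto
  ultimately show ?case by (intro exI[of _ "\<lambda>k. g (h k)"]) simp
qed

lemma Dickson: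
  fixes f :: "nat \<Rightarrow> mono"
  assumes "\<And>k. f k \<in> monomials n"
  shows "\<exists>i j. i < j \<and> mono_dvd (f i) (f j)"
proof -
  obtain g :: "nat \<Rightarrow> nat" where g: "strict_mono g"
    "\<forall>i<n. \<forall>j k. j \<le> k \<longrightarrow> Poly_Mapping.lookup (f (g j)) i \<le> Poly_Mapping.lookup (f (g k)) i"
    using Dickson_subseq[of n "\<lambda>k. Poly_Mapping.lookup (f k)"] by blast
  have "mono_dvd (f (g 0)) (f (g 1))"
    unfolding mono_dvd_iff
  proof
    fix i show "Poly_Mapping.lookup (f (g 0)) i \<le> Poly_Mapping.lookup (f (g 1)) i"
      using g(2) monomials_lookup[OF assms] by (cases "i < n") auto
  qed
  then show ?thesis using strict_monoD[OF g(1), of 0 1] by auto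
qed

lemma finite_antichain:
  assumes "S \<subseteq> monomials n" and "\<And>s t. s \<in> S \<Longrightarrow> t \<in> S \<Longrightarrow> mono_dvd s t \<Longrightarrow> s = t"
  shows "finite S"
proof (rule ccontr)
  assume "infinite S"
  then obtain f :: "nat \<Rightarrow> mono" where f: "inj f" "range f \<subseteq> S"
    using infinite_countable_subset by blast
  then obtain i j where "i < j" "mono_dvd (f i) (f j)"
    using Dickson[of f n] assms(1) by blast
  with f assms(2)[of "f i" "f j"] show False
    by (auto simp: inj_eq)
qed

context
  fixes n :: nat and r :: "mono rel"
  assumes r: "term_order n r"
begin

lemma term_order_refl: "s \<in> monomials n \<Longrightarrow> (s, s) \<in> r"
  using r by (auto simp: term_order_def order_on_defs refl_on_def)

lemma term_order_trans: "(s, t) \<in> r \<Longrightarrow> (t, u) \<in> r \<Longrightarrow> (s, u) \<in> r"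
  using r by (auto simp: term_order_def order_on_defs dest: transD)

lemma term_order_antisym: "(s, t) \<in> r \<Longrightarrow> (t, s) \<in> r \<Longrightarrow> s = t"
  using r by (auto simp: term_order_def order_on_defs dest: antisymD)

lemma term_order_total: "s \<in> monomials n \<Longrightarrow> t \<in> monomials n \<Longrightarrow> (s, t) \<in> r \<or> (t, s) \<in> r"
  using r term_order_refl by (cases "s = t") (auto simp: term_order_def order_on_defs total_on_def)

lemma term_order_add: "(s, t) \<in> r \<Longrightarrow> u \<in> monomials n \<Longrightarrow> (s + u, t + u) \<in> r"
  using r by (auto simp: term_order_def)

lemma term_order_dvd: "mono_dvd s t \<Longrightarrow> t \<in> monomials n \<Longrightarrow> (s, t) \<in> r"
  using r term_order_add[of 0 _ s]
  by (auto simp: mono_dvd_def monomials_add_iff term_order_def add.commute)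

text \<open>Well-foundedness: in a strictly decreasing sequence no monomial divides a later one, which
  contradicts Dickson's lemma.\<close>

lemma term_order_min:
  assumes "S \<subseteq> monomials n" "S \<noteq> {}"
  shows "\<exists>s\<in>S. \<forall>t\<in>S. (s, t) \<in> r"
proof (rule ccontr)
  assume "\<not> ?thesis"
  then have step: "\<exists>t\<in>S. (t, s) \<in> r \<and> t \<noteq> s" if "s \<in> S" for s
    using that assms(1) term_order_total term_order_refl by (metis in_mono)
  obtain s0 where "s0 \<in> S" using assms(2) by blast
  then have "\<exists>f. \<forall>k. f k \<in> S \<and> (f (Suc k), f k) \<in> r \<and> f (Suc k) \<noteq> f k"
    using dependent_nat_choice[of "\<lambda>_ s. s \<in> S" "\<lambda>_ s t. (t, s) \<in> r \<and> t \<noteq> s"] step by blast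
  then obtain f where f: "\<And>k. f k \<in> S" "\<And>k. (f (Suc k), f k) \<in> r" "\<And>k. f (Suc k) \<noteq> f k"
    by blast
  have dec: "(f (Suc (i + d)), f i) \<in> r \<and> f (Suc (i + d)) \<noteq> f i" for i d
  proof (induction d)
    case 0
    show ?case using f by simp
  next
    case (Suc d)
    show ?case
      using Suc f(2,3)[of "Suc (i + d)"] term_order_trans term_order_antisym by fastforce
  qed
  obtain i j where ij: "i < j" "mono_dvd (f i) (f j)"
    using Dickson[of f n] f(1) assms(1) by blast
  then obtain d where d: "j = Suc (i + d)"
    using less_imp_Suc_add by blast
  then have "(f i, f j) \<in> r"
    using term_order_dvd ij(2) f(1) assms(1) by blast
  with dec[of i d] d show False
    using term_order_antisym by blast
qed

lemma lead_monoI: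
  assumes "s \<in> Poly_Mapping.keys p" "\<And>t. t \<in> Poly_Mapping.keys p \<Longrightarrow> (t, s) \<in> r"
  shows "lead_mono r p = s"
  unfolding lead_mono_def by (rule the_equality) (use assms term_order_antisym in blast)+

lemma lead_mono_exists:
  fixes p :: "'k::field mpoly"
  assumes "p \<in> polys n" "p \<noteq> 0"
  shows "lead_mono r p \<in> Poly_Mapping.keys p"
    and "t \<in> Poly_Mapping.keys p \<Longrightarrow> (t, lead_mono r p) \<in> r"
proof -
  have "\<exists>s\<in>K. \<forall>t\<in>K. (t, s) \<in> r" if "finite K" "K \<noteq> {}" "K \<subseteq> monomials n" for K
    using that
  proof (induction K rule: finite_ne_induct)
    case (singleton x)
    then show ?case using term_order_refl by auto
  next
    case (insert x K)
    then obtain s where s: "s \<in> K" "\<forall>t\<in>K. (t, s) \<in> r" by auto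
    have "(s, x) \<in> r \<or> (x, s) \<in> r"
      using insert.prems s(1) by (intro term_order_total) auto
    then show ?case
    proof
      assume "(s, x) \<in> r"
      then have "\<forall>t\<in>insert x K. (t, x) \<in> r"
        using s(2) term_order_trans term_order_refl insert.prems by blast
      then show ?thesis by blast
    next
      assume "(x, s) \<in> r"
      then show ?thesis using s by blast
    qed
  qed
  from this[of "Poly_Mapping.keys p"] obtain s
    where s: "s \<in> Poly_Mapping.keys p" "\<forall>t\<in>Poly_Mapping.keys p. (t, s) \<in> r"
    using assms by (auto simp: polys_def)
  have "lead_mono r p = s" using s by (intro lead_monoI) auto
  then show "lead_mono r p \<in> Poly_Mapping.keys p"
    and "t \<in> Poly_Mapping.keys p \<Longrightarrow> (t, lead_mono r p) \<in> r"
    using s by auto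
qed

end

definition weight :: "nat \<Rightarrow> (nat \<Rightarrow> nat) \<Rightarrow> mono \<Rightarrow> nat" where
  "weight n c s = (\<Sum>i<n. c i * Poly_Mapping.lookup s i)"

text \<open>Ties are broken by the lexicographic order, which is \<open>\<le>\<close> on the type of monomials.\<close>

definition weight_order :: "nat \<Rightarrow> (nat \<Rightarrow> nat) \<Rightarrow> mono rel" where
  "weight_order n c = {(s, t). s \<in> monomials n \<and> t \<in> monomials n \<and>
     (weight n c s < weight n c t \<or> weight n c s = weight n c t \<and> s \<le> t)}"

lemma weight_add: "weight n c (s + t) = weight n c s + weight n c t"
  by (simp add: weight_def lookup_add algebra_simps sum.distrib)

lemma zero_le_mono: "(0 :: mono) \<le> s"
proof (rule ccontr)
  assume "\<not> 0 \<le> s"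
  then have "s < 0" by simp
  then show False
    by (simp add: less_poly_mapping.rep_eq less_fun_def)
qed

lemma term_order_weight_order: "term_order n (weight_order n c)"
proof -
  have "(0, s) \<in> weight_order n c" if "s \<in> monomials n" for s
    using that zero_le_mono[of s]
    by (auto simp: weight_order_def zero_in_monomials weight_def simp del: sum_eq_0_iff)
  moreover have "(s + u, t + u) \<in> weight_order n c"
    if "(s, t) \<in> weight_order n c" "u \<in> monomials n" for s t u
    using that by (auto simp: weight_order_def weight_add monomials_add_iff add_right_mono)
  moreover have "linear_order_on (monomials n) (weight_order n c)"
    unfolding order_on_defs total_on_def refl_on_def trans_def antisym_def weight_order_def by auto
  ultimately show ?thesis
    by (simp add: term_order_def)
qed


section \<open>Ideals generated by a set\<close>

lemma keys_mono_poly [simp]: "Poly_Mapping.keys (mono_poly s :: 'k::field mpoly) = {s}"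
  by (simp add: mono_poly_def)

lemma mono_poly_add: "(mono_poly (s + t) :: 'k::field mpoly) = mono_poly s * mono_poly t"
  by (simp add: mono_poly_def mult_single)

lemma mono_poly_inj: "(mono_poly s :: 'k::field mpoly) = mono_poly t \<longleftrightarrow> s = t"
  by (metis keys_mono_poly singleton_inject)

lemma mono_poly_in_polys: "(mono_poly s :: 'k::field mpoly) \<in> polys n \<longleftrightarrow> s \<in> monomials n"
  by (simp add: polys_def)

lemma polys_add: "p \<in> polys n \<Longrightarrow> q \<in> polys n \<Longrightarrow> p + q \<in> polys n"
  using Poly_Mapping.keys_add[of p q] by (auto simp: polys_def)

lemma polys_mult: "p \<in> polys n \<Longrightarrow> q \<in> polys n \<Longrightarrow> p * q \<in> polys n"
  using keys_mult[of p q] by (fastforce simp: polys_def monomials_add_iff)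

lemma polys_sum: "(\<And>x. x \<in> A \<Longrightarrow> f x \<in> polys n) \<Longrightarrow> sum f A \<in> polys n"
proof (induction A rule: infinite_finite_induct)
  case (insert x A)
  then show ?case by (simp add: polys_add)
qed (simp_all add: polys_def)

lemma ideal_gen_base:
  assumes "c \<in> polys n" "f \<in> S"
  shows "c * f \<in> ideal_gen n S"
  using assms unfolding ideal_gen_def by (intro CollectI exI[of _ "{f}"] exI[of _ "\<lambda>_. c"]) auto

lemma ideal_gen_0: "0 \<in> ideal_gen n S"
  unfolding ideal_gen_def by (intro CollectI exI[of _ "{}"]) auto

lemma ideal_gen_add:
  assumes "p \<in> ideal_gen n S" "q \<in> ideal_gen n S"
  shows "p + q \<in> ideal_gen n S"
proof -
  obtain F c where F: "p = (\<Sum>f\<in>F. c f * f)" "finite F" "F \<subseteq> S" "\<forall>f\<in>F. c f \<in> polys n"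
    using assms(1) unfolding ideal_gen_def by blast
  obtain H d where H: "q = (\<Sum>f\<in>H. d f * f)" "finite H" "H \<subseteq> S" "\<forall>f\<in>H. d f \<in> polys n"
    using assms(2) unfolding ideal_gen_def by blast
  define e where "e f = (if f \<in> F then c f else 0) + (if f \<in> H then d f else 0)" for f
  have "p = (\<Sum>f\<in>F \<union> H. (if f \<in> F then c f else 0) * f)"
    unfolding F(1) using F(2) H(2) by (intro sum.mono_neutral_cong_left) auto
  moreover have "q = (\<Sum>f\<in>F \<union> H. (if f \<in> H then d f else 0) * f)"
    unfolding H(1) using F(2) H(2) by (intro sum.mono_neutral_cong_left) auto
  ultimately have "p + q = (\<Sum>f\<in>F \<union> H. e f * f)"
    by (simp add: e_def algebra_simps sum.distrib)
  moreover have "\<forall>f\<in>F \<union> H. e f \<in> polys n"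
  proof
    fix f
    have "0 \<in> polys n" by (simp add: polys_def)
    then show "e f \<in> polys n"
      unfolding e_def using F(4) H(4) by (intro polys_add) auto
  qed
  ultimately show ?thesis
    unfolding ideal_gen_def using F H by (intro CollectI exI[of _ "F \<union> H"] exI[of _ e]) auto
qed

lemma ideal_gen_mult:
  assumes "p \<in> polys n" "q \<in> ideal_gen n S"
  shows "p * q \<in> ideal_gen n S"
proof -
  obtain H d where H: "q = (\<Sum>f\<in>H. d f * f)" "finite H" "H \<subseteq> S" "\<forall>f\<in>H. d f \<in> polys n"
    using assms(2) unfolding ideal_gen_def by blast
  have "p * q = (\<Sum>f\<in>H. (p * d f) * f)"
    by (simp add: H(1) sum_distrib_left mult.assoc)
  then show ?thesis
    unfolding ideal_gen_def using H polys_mult[OF assms(1)]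
    by (intro CollectI exI[of _ H] exI[of _ "\<lambda>f. p * d f"]) auto
qed

lemma ideal_gen_sum: "(\<And>x. x \<in> A \<Longrightarrow> f x \<in> ideal_gen n S) \<Longrightarrow> sum f A \<in> ideal_gen n S"
  by (induction A rule: infinite_finite_induct) (auto simp: ideal_gen_0 ideal_gen_add)

lemma ideal_gen_mono:
  assumes "S \<subseteq> ideal_gen n T"
  shows "ideal_gen n S \<subseteq> ideal_gen n T"
proof
  fix p assume "p \<in> ideal_gen n S"
  then obtain F c where "p = (\<Sum>f\<in>F. c f * f)" "finite F" "F \<subseteq> S" "\<forall>f\<in>F. c f \<in> polys n"
    unfolding ideal_gen_def by blast
  then show "p \<in> ideal_gen n T"
    using assms by (auto intro!: ideal_gen_sum ideal_gen_mult)
qed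

lemma monomial_ideal_dvd:
  assumes "(mono_poly t :: 'k::field mpoly) \<in> ideal_gen n (mono_poly ` L)"
  shows "\<exists>l\<in>L. mono_dvd l t"
proof -
  obtain F c where F: "(mono_poly t :: 'k mpoly) = (\<Sum>f\<in>F. c f * f)" "F \<subseteq> mono_poly ` L"
    using assms unfolding ideal_gen_def by blast
  have "t \<in> Poly_Mapping.keys (\<Sum>f\<in>F. c f * f)"
    unfolding F(1)[symmetric] by simp
  then obtain f where f: "f \<in> F" "t \<in> Poly_Mapping.keys (c f * f)"
    using keys_sum[of "\<lambda>f. c f * f" F] by auto
  then obtain a b where ab: "t = a + b" "b \<in> Poly_Mapping.keys f"
    using keys_mult[of "c f" f] by blast
  obtain l where l: "l \<in> L" "f = mono_poly l"
    using f(1) F(2) by blast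
  have "t = l + a"
    using ab l(2) by (simp add: add.commute)
  then show ?thesis
    unfolding mono_dvd_def using l(1) by blast
qed

lemma monomial_ideal_mono:
  assumes "\<And>t. t \<in> L \<Longrightarrow> t \<in> monomials n \<and> (\<exists>l\<in>L'. mono_dvd l t)"
  shows "ideal_gen n (mono_poly ` L) \<subseteq> ideal_gen n (mono_poly ` L' :: 'k::field mpoly set)"
proof (rule ideal_gen_mono, rule image_subsetI)
  fix t assume "t \<in> L"
  then obtain l m where l: "l \<in> L'" "t = l + m" "t \<in> monomials n"
    using assms unfolding mono_dvd_def by blast
  then have "(mono_poly m * mono_poly l :: 'k mpoly) \<in> ideal_gen n (mono_poly ` L')"
    by (intro ideal_gen_base) (auto simp: mono_poly_in_polys monomials_add_iff)
  then show "(mono_poly t :: 'k mpoly) \<in> ideal_gen n (mono_poly ` L')"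
    by (simp add: l(2) mono_poly_add mult.commute)
qed


section \<open>Fibres and the toric ideal\<close>

lemma mat_kernel_iff:
  "v \<in> mat_kernel M \<longleftrightarrow>
     v \<in> carrier_vec (dim_col M) \<and> (\<forall>i<dim_row M. (\<Sum>j<dim_col M. M $$ (i, j) * v $ j) = 0)"
  for M :: "int mat"
proof (cases "v \<in> carrier_vec (dim_col M)")
  case True
  have "(M *\<^sub>v v) $ i = (\<Sum>j<dim_col M. M $$ (i, j) * v $ j)" if "i < dim_row M" for i
    using that True by (simp add: scalar_prod_def atLeast0LessThan)
  moreover have "M *\<^sub>v v = 0\<^sub>v (dim_row M) \<longleftrightarrow> (\<forall>i<dim_row M. (M *\<^sub>v v) $ i = 0)"
    by (metis dim_mult_mat_vec eq_vecI index_zero_vec)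
  ultimately show ?thesis
    using True by (simp add: mat_kernel_def)
qed (simp add: mat_kernel_def)

lemma mat_kernel_uminus: "v \<in> mat_kernel M \<Longrightarrow> - v \<in> mat_kernel M" for M :: "int mat"
  by (auto simp: mat_kernel_iff sum_negf)

definition multidegree :: "int mat \<Rightarrow> mono \<Rightarrow> nat \<Rightarrow> int" where
  "multidegree M s i = (\<Sum>j<dim_col M. M $$ (i, j) * int (Poly_Mapping.lookup s j))"

definition same_fibre :: "int mat \<Rightarrow> mono \<Rightarrow> mono \<Rightarrow> bool" where
  "same_fibre M s t \<longleftrightarrow> s \<in> monomials (dim_col M) \<and> t \<in> monomials (dim_col M) \<and>
     (\<forall>i<dim_row M. multidegree M s i = multidegree M t i)"

lemma multidegree_add: "multidegree M (s + t) i = multidegree M s i + multidegree M t i"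
  by (simp add: multidegree_def lookup_add algebra_simps sum.distrib)

lemma same_fibre_monomials:
  assumes "same_fibre M s t"
  shows "s \<in> monomials (dim_col M)" "t \<in> monomials (dim_col M)"
  using assms by (auto simp: same_fibre_def)

lemma same_fibre_refl: "s \<in> monomials (dim_col M) \<Longrightarrow> same_fibre M s s"
  by (simp add: same_fibre_def)

lemma same_fibre_sym: "same_fibre M s t \<Longrightarrow> same_fibre M t s"
  by (simp add: same_fibre_def)

lemma same_fibre_trans: "same_fibre M s t \<Longrightarrow> same_fibre M t u \<Longrightarrow> same_fibre M s u"
  by (simp add: same_fibre_def)

lemma same_fibre_add_iff:
  "same_fibre M (s + u) (t + u) \<longleftrightarrow> same_fibre M s t \<and> u \<in> monomials (dim_col M)"
  by (auto simp: same_fibre_def monomials_add_iff multidegree_add)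

definition exp_diff :: "nat \<Rightarrow> mono \<Rightarrow> mono \<Rightarrow> int vec" where
  "exp_diff n s t = vec n (\<lambda>i. int (Poly_Mapping.lookup s i) - int (Poly_Mapping.lookup t i))"

lemma exp_diff_dim [simp]: "dim_vec (exp_diff n s t) = n"
  and exp_diff_carrier [simp]: "exp_diff n s t \<in> carrier_vec n"
  and exp_diff_index [simp]:
    "i < n \<Longrightarrow> exp_diff n s t $ i = int (Poly_Mapping.lookup s i) - int (Poly_Mapping.lookup t i)"
  by (auto simp: exp_diff_def)

lemma same_fibre_iff_kernel:
  "same_fibre M s t \<longleftrightarrow> s \<in> monomials (dim_col M) \<and> t \<in> monomials (dim_col M) \<and>
     exp_diff (dim_col M) s t \<in> mat_kernel M"
  by (auto simp: same_fibre_def mat_kernel_iff multidegree_def algebra_simps sum_subtractf)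

lemma lookup_pos_mono:
  "Poly_Mapping.lookup (pos_mono u) i = (if i < dim_vec u then nat (u $ i) else 0)"
  by (simp add: pos_mono_def lookup_sum lookup_single when_def)

lemma pos_mono_monomials: "pos_mono u \<in> monomials (dim_vec u)"
  by (auto simp: monomials_def in_keys_iff lookup_pos_mono split: if_splits)

lemma exp_diff_pos_mono: "u \<in> carrier_vec n \<Longrightarrow> exp_diff n (pos_mono u) (pos_mono (- u)) = u"
  by (rule eq_vecI) (auto simp: lookup_pos_mono)

lemma pos_mono_eq_iff:
  assumes "u \<in> carrier_vec n" "v \<in> carrier_vec n"
  shows "pos_mono u = pos_mono v \<and> pos_mono (- u) = pos_mono (- v) \<longleftrightarrow> u = v"
proof
  assume "pos_mono u = pos_mono v \<and> pos_mono (- u) = pos_mono (- v)"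
  then have "exp_diff n (pos_mono u) (pos_mono (- u)) = exp_diff n (pos_mono v) (pos_mono (- v))"
    by (simp only:)
  then show "u = v"
    by (simp only: exp_diff_pos_mono[OF assms(1)] exp_diff_pos_mono[OF assms(2)])
qed simp

lemma pos_mono_neq:
  assumes "u \<in> carrier_vec n"
  shows "pos_mono u = pos_mono (- u) \<longleftrightarrow> u = 0\<^sub>v n"
proof
  assume *: "pos_mono u = pos_mono (- u)"
  show "u = 0\<^sub>v n"
  proof (rule eq_vecI)
    fix i assume "i < dim_vec (0\<^sub>v n)"
    then show "u $ i = 0\<^sub>v n $ i"
      using arg_cong[OF *, of "\<lambda>s. Poly_Mapping.lookup s i"] assms by (auto simp: lookup_pos_mono)
  qed (use assms in auto)
next
  assume "u = 0\<^sub>v n"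
  then show "pos_mono u = pos_mono (- u)"
    by (intro poly_mapping_eqI) (simp add: lookup_pos_mono)
qed

lemma same_fibre_pos_mono:
  assumes "u \<in> carrier_vec (dim_col M)"
  shows "same_fibre M (pos_mono u) (pos_mono (- u)) \<longleftrightarrow> u \<in> mat_kernel M"
  using assms pos_mono_monomials[of u] pos_mono_monomials[of "- u"]
  by (auto simp: same_fibre_iff_kernel exp_diff_pos_mono)

lemma keys_binomial:
  "s \<noteq> t \<Longrightarrow> Poly_Mapping.keys (mono_poly s - mono_poly t :: 'k::field mpoly) = {s, t}"
  by (auto simp: in_keys_iff mono_poly_def lookup_minus lookup_single when_def split: if_splits)

lemma binom_uminus: "(binom (- u) :: 'k::field mpoly) = - binom u"
  by (simp add: binom_def)

lemma binom_eq_0_iff: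
  assumes "u \<in> carrier_vec n"
  shows "(binom u :: 'k::field mpoly) = 0 \<longleftrightarrow> u = 0\<^sub>v n"
  using pos_mono_neq[OF assms] by (simp add: binom_def mono_poly_inj)

lemma keys_binom:
  assumes "u \<in> carrier_vec n" "u \<noteq> 0\<^sub>v n"
  shows "Poly_Mapping.keys (binom u :: 'k::field mpoly) = {pos_mono u, pos_mono (- u)}"
  unfolding binom_def using assms by (intro keys_binomial) (simp add: pos_mono_neq)

text \<open>In characteristic 2 the binomial determines the vector only up to sign.\<close>

lemma binom_eq_binom:
  assumes "u \<in> carrier_vec n" "v \<in> carrier_vec n" "u \<noteq> 0\<^sub>v n"
    and "(binom u :: 'k::field mpoly) = binom v"
  shows "v = u \<or> v = - u"
proof -
  have "v \<noteq> 0\<^sub>v n"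
    using assms binom_eq_0_iff[OF assms(1), where 'k='k] binom_eq_0_iff[OF assms(2), where 'k='k] by simp
  then have "{pos_mono u, pos_mono (- u)} = {pos_mono v, pos_mono (- v)}"
    using keys_binom[OF assms(1,3), where 'k='k] keys_binom[OF assms(2), where 'k='k] assms(4) by simp
  moreover have "- (- u) = u" by simp
  ultimately show ?thesis
    using pos_mono_eq_iff[OF assms(1,2)] pos_mono_eq_iff[of "- u" n v] assms(1,2)
    by (auto simp: doubleton_eq_iff)
qed

lemma binomial_in_toric_ideal:
  assumes "same_fibre M s t"
  shows "(mono_poly s - mono_poly t :: 'k::field mpoly) \<in> toric_ideal M"
proof -
  let ?n = "dim_col M" and ?u = "exp_diff (dim_col M) s t"
  define m where "m = s - pos_mono ?u"
  note st = same_fibre_monomials[OF assms]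
  have s: "s = m + pos_mono ?u"
    by (rule poly_mapping_eqI)
       (simp add: m_def lookup_add lookup_minus lookup_pos_mono)
  then have m: "m \<in> monomials ?n"
    using st(1) monomials_add_iff by metis
  have "t = m + pos_mono (- ?u)"
    by (rule poly_mapping_eqI)
       (use monomials_lookup[OF st(1)] monomials_lookup[OF st(2)]
         in \<open>auto simp: m_def lookup_add lookup_minus lookup_pos_mono\<close>)
  then have "(mono_poly s - mono_poly t :: 'k mpoly) = mono_poly m * binom ?u"
    using s unfolding binom_def right_diff_distrib mono_poly_add[symmetric] by metis
  then show ?thesis
    unfolding toric_ideal_def using assms m
    by (auto simp: same_fibre_iff_kernel mono_poly_in_polys intro!: ideal_gen_base)
qed

text \<open>The toric ideal is homogeneous for the grading by fibres, and the coefficients of each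
  homogeneous component of a member add up to \<open>0\<close>.\<close>

definition fibre_sum :: "int mat \<Rightarrow> mono \<Rightarrow> 'k::field mpoly \<Rightarrow> 'k" where
  "fibre_sum M s p = (\<Sum>t\<in>Poly_Mapping.keys p. if same_fibre M s t then Poly_Mapping.lookup p t else 0)"

lemma fibre_sum_add: "fibre_sum M s (p + q) = fibre_sum M s p + fibre_sum M s q"
  unfolding fibre_sum_def
  by (rule setsum_keys_plus_distrib[of "\<lambda>t c. if same_fibre M s t then c else 0"]) auto

lemma fibre_sum_0 [simp]: "fibre_sum M s 0 = 0"
  by (simp add: fibre_sum_def)

lemma fibre_sum_sum: "fibre_sum M s (sum f A) = (\<Sum>x\<in>A. fibre_sum M s (f x))"
  by (induction A rule: infinite_finite_induct) (auto simp: fibre_sum_add)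

lemma fibre_sum_single: "fibre_sum M s (Poly_Mapping.single t c) = (if same_fibre M s t then c else 0)"
  by (cases "c = 0") (auto simp: fibre_sum_def)

lemma sum_singles: "(\<Sum>t\<in>Poly_Mapping.keys p. Poly_Mapping.single t (Poly_Mapping.lookup p t)) = p"
  by (rule poly_mapping_eqI) (auto simp: lookup_sum lookup_single when_def in_keys_iff)

lemma toric_ideal_polys:
  fixes p :: "'k::field mpoly"
  assumes "p \<in> toric_ideal M"
  shows "p \<in> polys (dim_col M)"
proof -
  obtain F c where F: "p = (\<Sum>f\<in>F. c f * f)" "F \<subseteq> binom ` mat_kernel M"
      "\<forall>f\<in>F. c f \<in> polys (dim_col M)"
    using assms unfolding toric_ideal_def ideal_gen_def by blast
  have "(binom u :: 'k mpoly) \<in> polys (dim_col M)" if u: "u \<in> mat_kernel M" for u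
  proof -
    have "dim_vec u = dim_col M" using u by (simp add: mat_kernel_iff)
    then show ?thesis
      using keys_diff[of "mono_poly (pos_mono u)" "mono_poly (pos_mono (- u))"]
        pos_mono_monomials[of u] pos_mono_monomials[of "- u"]
      by (auto simp: polys_def binom_def)
  qed
  then show ?thesis
    unfolding F(1) using F(2,3) by (intro polys_sum polys_mult) auto
qed

lemma toric_ideal_fibre_sum:
  fixes p :: "'k::field mpoly"
  assumes "p \<in> toric_ideal M"
  shows "fibre_sum M s p = 0"
proof -
  obtain F c where F: "p = (\<Sum>f\<in>F. c f * f)" "F \<subseteq> binom ` mat_kernel M"
      "\<forall>f\<in>F. c f \<in> polys (dim_col M)"
    using assms unfolding toric_ideal_def ideal_gen_def by blast
  have "fibre_sum M s (q * binom u) = 0" if q: "q \<in> polys (dim_col M)" and u: "u \<in> mat_kernel M"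
    for q :: "'k mpoly" and u
  proof -
    let ?a = "pos_mono u" and ?b = "pos_mono (- u)"
    have eq: "Poly_Mapping.single t a * binom u
        = Poly_Mapping.single (?a + t) a + Poly_Mapping.single (?b + t) (- a)" for t a
      by (simp add: binom_def mono_poly_def right_diff_distrib mult_single single_uminus add.commute)
    have "same_fibre M ?a ?b"
      using u by (simp add: same_fibre_pos_mono mat_kernel_iff)
    then have "same_fibre M (?a + t) (?b + t)" if "t \<in> monomials (dim_col M)" for t
      using that by (simp add: same_fibre_add_iff)
    then have "same_fibre M s (?a + t) \<longleftrightarrow> same_fibre M s (?b + t)" if "t \<in> Poly_Mapping.keys q" for t
      using that q same_fibre_trans same_fibre_sym unfolding polys_def by blast
    then have "fibre_sum M s (Poly_Mapping.single t (Poly_Mapping.lookup q t) * binom u) = 0"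
      if "t \<in> Poly_Mapping.keys q" for t
      using that by (simp add: eq fibre_sum_add fibre_sum_single)
    then have "fibre_sum M s
        (\<Sum>t\<in>Poly_Mapping.keys q. Poly_Mapping.single t (Poly_Mapping.lookup q t) * binom u) = 0"
      by (simp add: fibre_sum_sum)
    then show ?thesis
      by (simp add: sum_distrib_right[symmetric] sum_singles)
  qed
  then have "fibre_sum M s (c f * f) = 0" if "f \<in> F" for f
    using that F(2,3) by auto
  then show ?thesis
    by (simp add: F(1) fibre_sum_sum)
qed

text \<open>A monomial that were alone in its fibre would have its own coefficient as fibre sum.\<close>

lemma toric_ideal_other_key:
  assumes "p \<in> toric_ideal M" "s \<in> Poly_Mapping.keys p"
  shows "\<exists>t\<in>Poly_Mapping.keys p. t \<noteq> s \<and> same_fibre M s t"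
proof (rule ccontr)
  assume no: "\<not> ?thesis"
  have "same_fibre M s s"
    using toric_ideal_polys[OF assms(1)] assms(2) by (auto simp: polys_def same_fibre_refl)
  then have "fibre_sum M s p
      = (\<Sum>t\<in>Poly_Mapping.keys p. if t = s then Poly_Mapping.lookup p s else 0)"
    unfolding fibre_sum_def using no by (intro sum.cong) auto
  then have "fibre_sum M s p = Poly_Mapping.lookup p s"
    using assms(2) by simp
  then show False
    using toric_ideal_fibre_sum[OF assms(1)] assms(2) by (simp add: in_keys_iff)
qed

lemma binom_in_toric_ideal_iff:
  assumes "u \<in> carrier_vec (dim_col M)"
  shows "(binom u :: 'k::field mpoly) \<in> toric_ideal M \<longleftrightarrow> u \<in> mat_kernel M"
proof
  assume "u \<in> mat_kernel M"
  then show "(binom u :: 'k mpoly) \<in> toric_ideal M"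
    unfolding binom_def using assms by (intro binomial_in_toric_ideal) (simp add: same_fibre_pos_mono)
next
  assume *: "(binom u :: 'k mpoly) \<in> toric_ideal M"
  show "u \<in> mat_kernel M"
  proof (cases "u = 0\<^sub>v (dim_col M)")
    case True
    then show ?thesis by (simp add: mat_kernel_iff)
  next
    case False
    then have "same_fibre M (pos_mono u) (pos_mono (- u))"
      using toric_ideal_other_key[OF *, of "pos_mono u"] keys_binom[OF assms False, where 'k='k] by auto
    then show ?thesis using assms by (simp add: same_fibre_pos_mono)
  qed
qed


section \<open>Reduced Groebner bases of toric ideals\<close>

text \<open>These are exactly the monomials of the initial ideal: if \<open>t\<close> is below \<open>s\<close> in the fibre of \<open>s\<close>,
  then \<open>s\<close> is the lead monomial of the member \<open>x\<^sup>s - x\<^sup>t\<close> of the toric ideal, and conversely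
  every lead monomial of a member shares its fibre with another monomial of that member.\<close>

definition nonstandard :: "int mat \<Rightarrow> mono rel \<Rightarrow> mono set" where
  "nonstandard M r = {s. \<exists>t. same_fibre M t s \<and> t \<noteq> s \<and> (t, s) \<in> r}"

definition minimal_nonstandard :: "int mat \<Rightarrow> mono rel \<Rightarrow> mono set" where
  "minimal_nonstandard M r = {s \<in> nonstandard M r. \<forall>v\<in>nonstandard M r. mono_dvd v s \<longrightarrow> v = s}"

lemma nonstandard_monomials: "nonstandard M r \<subseteq> monomials (dim_col M)"
  by (auto simp: nonstandard_def dest: same_fibre_monomials)

context
  fixes M :: "int mat" and r :: "mono rel"
  assumes r: "term_order (dim_col M) r"
begin

lemma nonstandard_dvd:
  assumes "s \<in> nonstandard M r" "mono_dvd s t" "t \<in> monomials (dim_col M)"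
  shows "t \<in> nonstandard M r"
proof -
  obtain m where m: "t = s + m" "m \<in> monomials (dim_col M)"
    using assms(2,3) by (auto simp: mono_dvd_def monomials_add_iff)
  obtain s' where s': "same_fibre M s' s" "s' \<noteq> s" "(s', s) \<in> r"
    using assms(1) by (auto simp: nonstandard_def)
  then have "same_fibre M (s' + m) t \<and> s' + m \<noteq> t \<and> (s' + m, t) \<in> r"
    using m term_order_add[OF r] by (auto simp: same_fibre_add_iff)
  then show ?thesis
    unfolding nonstandard_def by blast
qed

lemma standard_unique:
  assumes "same_fibre M s t" "s \<notin> nonstandard M r" "t \<notin> nonstandard M r"
  shows "s = t"
  using assms same_fibre_sym[OF assms(1)] term_order_total[OF r same_fibre_monomials[OF assms(1)]]
  unfolding nonstandard_def by blast

lemma standard_le: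
  assumes "same_fibre M s t" "s \<notin> nonstandard M r"
  shows "(s, t) \<in> r"
  using assms same_fibre_sym[OF assms(1)] term_order_total[OF r same_fibre_monomials[OF assms(1)]]
    term_order_refl[OF r same_fibre_monomials(1)[OF assms(1)]]
  unfolding nonstandard_def by blast

lemma standard_exists:
  assumes "s \<in> monomials (dim_col M)"
  shows "\<exists>t. same_fibre M s t \<and> t \<notin> nonstandard M r"
proof -
  have "{t. same_fibre M s t} \<subseteq> monomials (dim_col M)" "{t. same_fibre M s t} \<noteq> {}"
    using assms same_fibre_monomials same_fibre_refl by blast+
  from term_order_min[OF r this]
  obtain t where t: "same_fibre M s t" "\<And>u. same_fibre M s u \<Longrightarrow> (t, u) \<in> r"
    by blast
  have "t \<notin> nonstandard M r"
  proof
    assume "t \<in> nonstandard M r"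
    then obtain u where "same_fibre M u t" "u \<noteq> t" "(u, t) \<in> r"
      by (auto simp: nonstandard_def)
    then show False
      using t same_fibre_trans[OF t(1)] same_fibre_sym term_order_antisym[OF r] by blast
  qed
  with t(1) show ?thesis by blast
qed

lemma minimal_nonstandard_dvd:
  assumes "s \<in> nonstandard M r"
  shows "\<exists>l\<in>minimal_nonstandard M r. mono_dvd l s"
proof -
  let ?S = "{l \<in> nonstandard M r. mono_dvd l s}"
  have "?S \<subseteq> monomials (dim_col M)" "?S \<noteq> {}"
    using assms nonstandard_monomials by (auto simp: mono_dvd_iff)
  from term_order_min[OF r this]
  obtain l where l: "l \<in> ?S" "\<And>v. v \<in> ?S \<Longrightarrow> (l, v) \<in> r"
    by blast
  have "v = l" if "v \<in> nonstandard M r" "mono_dvd v l" for v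
  proof -
    have "(v, l) \<in> r"
      using that(2) l(1) nonstandard_monomials by (intro term_order_dvd[OF r]) auto
    moreover have "(l, v) \<in> r"
      using that l(1) mono_dvd_trans by (intro l(2)) blast
    ultimately show ?thesis
      by (rule term_order_antisym[OF r])
  qed
  then show ?thesis
    using l(1) unfolding minimal_nonstandard_def by blast
qed

lemma finite_minimal_nonstandard: "finite (minimal_nonstandard M r)"
  using nonstandard_monomials
  by (intro finite_antichain[of _ "dim_col M"]) (auto simp: minimal_nonstandard_def)

text \<open>A common variable could be cancelled, which would leave a nonstandard proper divisor.\<close>

lemma minimal_nonstandard_disjoint:
  assumes s: "s \<in> minimal_nonstandard M r" and w: "same_fibre M w s" "(w, s) \<in> r" "w \<noteq> s"
  shows "Poly_Mapping.lookup w i = 0 \<or> Poly_Mapping.lookup s i = 0"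
proof (rule ccontr)
  assume *: "\<not> ?thesis"
  let ?e = "Poly_Mapping.single i (1 :: nat)"
  have eq: "w = (w - ?e) + ?e" "s = (s - ?e) + ?e"
    using * by (auto intro!: poly_mapping_eqI simp: lookup_add lookup_minus lookup_single when_def)
  then have fib: "same_fibre M (w - ?e) (s - ?e)"
    using w(1) same_fibre_add_iff by metis
  have e: "?e \<in> monomials (dim_col M)"
    using eq(1) same_fibre_monomials(1)[OF w(1)] monomials_add_iff by metis
  have "(s - ?e, w - ?e) \<notin> r"
    using term_order_add[OF r _ e, of "s - ?e" "w - ?e"] eq w(2,3) term_order_antisym[OF r] by metis
  then have "(w - ?e, s - ?e) \<in> r"
    using term_order_total[OF r same_fibre_monomials[OF fib]] by blast
  moreover have "w - ?e \<noteq> s - ?e"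
    using w(3) eq by metis
  ultimately have "s - ?e \<in> nonstandard M r"
    using fib unfolding nonstandard_def by blast
  moreover have "mono_dvd (s - ?e) s"
    using eq(2) unfolding mono_dvd_def by blast
  ultimately have "s - ?e = s"
    using s by (simp add: minimal_nonstandard_def)
  then have "Poly_Mapping.lookup (s - ?e) i = Poly_Mapping.lookup s i" by simp
  then have "Poly_Mapping.lookup s i - 1 = Poly_Mapping.lookup s i"
    by (simp add: lookup_minus)
  then show False using * by linarith
qed

lemma lead_binomial:
  assumes "s \<in> monomials (dim_col M)" "(t, s) \<in> r" "t \<noteq> s"
  shows "lead_mono r (mono_poly s - mono_poly t :: 'k::field mpoly) = s"
  using assms keys_binomial[of s t, where 'k='k] term_order_refl[OF r]
  by (intro lead_monoI[OF r]) auto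

lemma lead_monomials_toric_ideal:
  "lead_mono r ` (toric_ideal M - {0 :: 'k::field mpoly}) = nonstandard M r"
proof (intro equalityI subsetI)
  fix s assume "s \<in> lead_mono r ` (toric_ideal M - {0 :: 'k mpoly})"
  then obtain p :: "'k mpoly" where p: "p \<in> toric_ideal M" "p \<noteq> 0" "s = lead_mono r p"
    by blast
  note lead = lead_mono_exists[OF r toric_ideal_polys[OF p(1)] p(2)]
  obtain t where "t \<in> Poly_Mapping.keys p" "t \<noteq> s" "same_fibre M s t"
    using toric_ideal_other_key[OF p(1) lead(1)] p(3) by blast
  then show "s \<in> nonstandard M r"
    unfolding nonstandard_def using lead(2) p(3) same_fibre_sym by blast
next
  fix s assume "s \<in> nonstandard M r"
  then obtain t where t: "same_fibre M t s" "t \<noteq> s" "(t, s) \<in> r"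
    by (auto simp: nonstandard_def)
  have "(mono_poly s - mono_poly t :: 'k mpoly) \<in> toric_ideal M - {0}"
    using t binomial_in_toric_ideal[OF same_fibre_sym[OF t(1)]] by (simp add: mono_poly_inj)
  moreover have "s = lead_mono r (mono_poly s - mono_poly t :: 'k mpoly)"
    using t lead_binomial same_fibre_monomials by metis
  ultimately show "s \<in> lead_mono r ` (toric_ideal M - {0 :: 'k mpoly})"
    by blast
qed

lemma initial_ideal_toric_ideal:
  "initial_ideal (dim_col M) r (toric_ideal M :: 'k::field mpoly set)
     = ideal_gen (dim_col M) (mono_poly ` nonstandard M r)"
  unfolding initial_ideal_def lead_monomials_toric_ideal[symmetric, where 'k='k]
  by (simp add: image_image)

lemma reduced_groebner_basis_divisor:
  fixes G :: "'k::field mpoly set"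
  assumes G: "reduced_groebner_basis (dim_col M) r (toric_ideal M) G" and v: "v \<in> nonstandard M r"
  shows "\<exists>h\<in>G. mono_dvd (lead_mono r h) v"
proof -
  have "(mono_poly 0 * mono_poly v :: 'k mpoly)
      \<in> ideal_gen (dim_col M) (mono_poly ` nonstandard M r)"
    using v by (intro ideal_gen_base) (auto simp: mono_poly_in_polys zero_in_monomials)
  then have "(mono_poly v :: 'k mpoly) \<in> ideal_gen (dim_col M) (mono_poly ` (lead_mono r ` G))"
    using G unfolding reduced_groebner_basis_def initial_ideal_toric_ideal
    by (simp add: image_image mono_poly_add[symmetric])
  then show ?thesis
    using monomial_ideal_dvd by blast
qed

text \<open>The lead monomial of an element is divisible by no other lead monomial, so it is a minimal
  nonstandard monomial; all other monomials are standard. As no monomial is alone in its fibre and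
  every fibre has only one standard monomial, just one other monomial remains.\<close>

lemma reduced_groebner_basis_element:
  fixes G :: "'k::field mpoly set"
  assumes G: "reduced_groebner_basis (dim_col M) r (toric_ideal M) G" and g: "g \<in> G"
  shows "\<exists>s t. g = mono_poly s - mono_poly t \<and> same_fibre M s t \<and>
           s \<in> minimal_nonstandard M r \<and> t \<notin> nonstandard M r"
proof -
  let ?s = "lead_mono r g"
  have gI: "g \<in> toric_ideal M" "g \<noteq> 0" and monic: "Poly_Mapping.lookup g ?s = 1"
    and red: "\<And>h t. h \<in> G \<Longrightarrow> h \<noteq> g \<Longrightarrow> t \<in> Poly_Mapping.keys g \<Longrightarrow> \<not> mono_dvd (lead_mono r h) t"
    using G g unfolding reduced_groebner_basis_def by auto
  note lead = lead_mono_exists[OF r toric_ideal_polys[OF gI(1)] gI(2)]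
  note divisor = reduced_groebner_basis_divisor[OF G]
  have s_mem: "?s \<in> nonstandard M r"
    using gI lead_monomials_toric_ideal[where 'k='k] by blast
  have "v = ?s" if v: "v \<in> nonstandard M r" "mono_dvd v ?s" for v
  proof -
    obtain h where h: "h \<in> G" "mono_dvd (lead_mono r h) v"
      using divisor v(1) by blast
    then have "h = g"
      using red[of h ?s] lead(1) mono_dvd_trans[OF h(2) v(2)] by blast
    then show ?thesis
      using h(2) v(2) mono_dvd_antisym by blast
  qed
  then have s_min: "?s \<in> minimal_nonstandard M r"
    using s_mem by (simp add: minimal_nonstandard_def)
  have std: "t \<notin> nonstandard M r" if t: "t \<in> Poly_Mapping.keys g" "t \<noteq> ?s" for t
  proof
    assume "t \<in> nonstandard M r"
    then obtain h where h: "h \<in> G" "mono_dvd (lead_mono r h) t"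
      using divisor by blast
    then have "h = g"
      using red t(1) by blast
    then have "(?s, t) \<in> r"
      using h(2) t(1) toric_ideal_polys[OF gI(1)]
      by (intro term_order_dvd[OF r]) (auto simp: polys_def)
    then show False
      using lead(2)[OF t(1)] t(2) term_order_antisym[OF r] by blast
  qed
  have fib: "same_fibre M ?s t" if t: "t \<in> Poly_Mapping.keys g" "t \<noteq> ?s" for t
  proof -
    obtain u where u: "u \<in> Poly_Mapping.keys g" "u \<noteq> t" "same_fibre M t u"
      using toric_ideal_other_key[OF gI(1) t(1)] by blast
    then have "u = ?s"
      using standard_unique[OF u(3)] std t by blast
    then show ?thesis
      using u(3) same_fibre_sym by blast
  qed
  obtain t where t: "t \<in> Poly_Mapping.keys g" "t \<noteq> ?s"
    using toric_ideal_other_key[OF gI(1) lead(1)] by blast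
  have "u = t" if "u \<in> Poly_Mapping.keys g" "u \<noteq> ?s" for u
    using that t std fib standard_unique same_fibre_trans same_fibre_sym by metis
  then have keys: "Poly_Mapping.keys g = {?s, t}"
    using t(1) lead(1) by blast
  have "fibre_sum M ?s g = Poly_Mapping.lookup g ?s + Poly_Mapping.lookup g t"
    using t fib[OF t] same_fibre_refl[OF same_fibre_monomials(1)[OF fib[OF t]]]
    by (simp add: fibre_sum_def keys)
  then have "Poly_Mapping.lookup g t = - 1"
    using toric_ideal_fibre_sum[OF gI(1)] monic by (simp add: eq_neg_iff_add_eq_0 add.commute)
  moreover have "Poly_Mapping.lookup g k = 0" if "k \<noteq> ?s" "k \<noteq> t" for k
    using that keys by (metis in_keys_iff insertE singletonD)
  ultimately have "g = mono_poly ?s - mono_poly t"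
    using monic t(2)
    by (intro poly_mapping_eqI) (auto simp: mono_poly_def lookup_minus lookup_single when_def)
  then show ?thesis
    using fib[OF t] s_min std[OF t] by blast
qed

text \<open>The binomials joining each minimal nonstandard monomial to the standard monomial of its fibre.\<close>

lemma reduced_groebner_basis_exists:
  "\<exists>G :: 'k::field mpoly set. reduced_groebner_basis (dim_col M) r (toric_ideal M) G"
proof -
  let ?N = "nonstandard M r" and ?L = "minimal_nonstandard M r"
  obtain nf where nf: "\<And>s. s \<in> monomials (dim_col M) \<Longrightarrow> same_fibre M s (nf s) \<and> nf s \<notin> ?N"
    using standard_exists by metis
  define b :: "mono \<Rightarrow> 'k mpoly" where "b s = mono_poly s - mono_poly (nf s)" for s
  have N: "s \<in> ?N" if "s \<in> ?L" for s
    using that by (simp add: minimal_nonstandard_def)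
  then have mon: "s \<in> monomials (dim_col M)" if "s \<in> ?L" for s
    using that nonstandard_monomials by blast
  then have fib: "same_fibre M s (nf s)" and std: "nf s \<notin> ?N" if "s \<in> ?L" for s
    using that nf by auto
  then have neq: "nf s \<noteq> s" if "s \<in> ?L" for s
    using that N by force
  have lead: "lead_mono r (b s) = s" if "s \<in> ?L" for s
    unfolding b_def using that mon neq standard_le same_fibre_sym fib std
    by (intro lead_binomial) blast+
  have keys: "Poly_Mapping.keys (b s) = {s, nf s}" if "s \<in> ?L" for s
    unfolding b_def using neq[OF that] by (intro keys_binomial) simp
  have "ideal_gen (dim_col M) ((\<lambda>g. mono_poly (lead_mono r g)) ` b ` ?L)
      = ideal_gen (dim_col M) (mono_poly ` ?L :: 'k mpoly set)"
    using lead by (simp add: image_image cong: image_cong)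
  also have "\<dots> = ideal_gen (dim_col M) (mono_poly ` ?N)"
  proof
    show "ideal_gen (dim_col M) (mono_poly ` ?L :: 'k mpoly set)
        \<subseteq> ideal_gen (dim_col M) (mono_poly ` ?N)"
      using mon N by (intro monomial_ideal_mono) (auto simp: mono_dvd_iff)
    show "ideal_gen (dim_col M) (mono_poly ` ?N :: 'k mpoly set)
        \<subseteq> ideal_gen (dim_col M) (mono_poly ` ?L)"
      using minimal_nonstandard_dvd nonstandard_monomials by (intro monomial_ideal_mono) blast
  qed
  finally have init: "ideal_gen (dim_col M) ((\<lambda>g. mono_poly (lead_mono r g)) ` b ` ?L)
      = initial_ideal (dim_col M) r (toric_ideal M :: 'k mpoly set)"
    by (simp add: initial_ideal_toric_ideal)
  have "\<not> mono_dvd (lead_mono r (b l)) t"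
    if "s \<in> ?L" "l \<in> ?L" "b l \<noteq> b s" "t \<in> Poly_Mapping.keys (b s)" for s l t
  proof
    assume "mono_dvd (lead_mono r (b l)) t"
    then have dvd: "mono_dvd l t" using lead that(2) by simp
    have "t = s \<or> t = nf s"
      using that(4) keys[OF that(1)] by blast
    then show False
    proof
      assume "t = s"
      then have "l = s"
        using that(1) N[OF that(2)] dvd by (auto simp: minimal_nonstandard_def)
      then show False using that(3) by simp
    next
      assume "t = nf s"
      then show False
        using nonstandard_dvd[OF N[OF that(2)] dvd] std[OF that(1)]
          same_fibre_monomials(2)[OF fib[OF that(1)]] by simp
    qed
  qed
  moreover have "Poly_Mapping.lookup (b s) s = 1" if "s \<in> ?L" for s
    using neq[OF that] by (simp add: b_def mono_poly_def lookup_minus lookup_single when_def)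
  moreover have "b s \<in> toric_ideal M" if "s \<in> ?L" for s
    unfolding b_def using fib[OF that] by (rule binomial_in_toric_ideal)
  moreover have "b s \<noteq> 0" if "s \<in> ?L" for s
    using keys[OF that] by auto
  ultimately have "reduced_groebner_basis (dim_col M) r (toric_ideal M) (b ` ?L)"
    unfolding reduced_groebner_basis_def using init finite_minimal_nonstandard lead
    by (auto simp: image_iff)
  then show ?thesis by blast
qed

end


section \<open>The Graver basis and the universal Groebner basis\<close>

text \<open>The two divisibility conditions of the Graver basis, in a form suited to linear arithmetic.\<close>

definition conformal :: "int vec \<Rightarrow> int vec \<Rightarrow> bool" where
  "conformal v u \<longleftrightarrow> (\<forall>i<dim_vec u. 0 \<le> v $ i \<and> v $ i \<le> u $ i \<or> u $ i \<le> v $ i \<and> v $ i \<le> 0)"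

definition primitive_vec :: "int mat \<Rightarrow> int vec \<Rightarrow> bool" where
  "primitive_vec M u \<longleftrightarrow> u \<in> mat_kernel M \<and> u \<noteq> 0\<^sub>v (dim_col M) \<and>
     (\<forall>v\<in>mat_kernel M. conformal v u \<longrightarrow> v = 0\<^sub>v (dim_col M) \<or> v = u)"

lemma mat_kernel_dim: "u \<in> mat_kernel M \<Longrightarrow> u \<in> carrier_vec (dim_col M)"
  by (simp add: mat_kernel_def)

lemma conformal_iff_dvd:
  assumes "dim_vec v = dim_vec u"
  shows "conformal v u \<longleftrightarrow>
    mono_dvd (pos_mono v) (pos_mono u) \<and> mono_dvd (pos_mono (- v)) (pos_mono (- u))"
proof -
  have "(0 \<le> a \<and> a \<le> b \<or> b \<le> a \<and> a \<le> 0) \<longleftrightarrow> nat a \<le> nat b \<and> nat (- a) \<le> nat (- b)" for a b :: int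
    by linarith
  then show ?thesis
    using assms unfolding conformal_def mono_dvd_iff by (auto simp: lookup_pos_mono)
qed

lemma primitive_vec_uminus:
  assumes "primitive_vec M u"
  shows "primitive_vec M (- u)"
proof -
  have u: "u \<in> mat_kernel M" "u \<noteq> 0\<^sub>v (dim_col M)"
    and prim: "\<And>v. v \<in> mat_kernel M \<Longrightarrow> conformal v u \<Longrightarrow> v = 0\<^sub>v (dim_col M) \<or> v = u"
    using assms by (auto simp: primitive_vec_def)
  note dim = mat_kernel_dim[OF u(1)]
  have "v = 0\<^sub>v (dim_col M) \<or> v = - u" if v: "v \<in> mat_kernel M" "conformal v (- u)" for v
  proof -
    note vdim = mat_kernel_dim[OF v(1)]
    have "conformal (- v) u"
      using v(2) dim vdim by (simp add: conformal_iff_dvd)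
    then have "- v = 0\<^sub>v (dim_col M) \<or> - v = u"
      using prim mat_kernel_uminus[OF v(1)] by blast
    then have "- (- v) = - 0\<^sub>v (dim_col M) \<or> - (- v) = - u" by metis
    then show ?thesis by simp
  qed
  moreover have "- u \<noteq> 0\<^sub>v (dim_col M)"
  proof
    assume "- u = 0\<^sub>v (dim_col M)"
    then have "- (- u) = - 0\<^sub>v (dim_col M)" by (simp only:)
    then show False using u(2) by simp
  qed
  ultimately show ?thesis
    using mat_kernel_uminus[OF u(1)] by (simp add: primitive_vec_def)
qed

lemma graver_eq: "(graver M :: 'k::field mpoly set) = binom ` {u. primitive_vec M u}"
proof -
  let ?n = "dim_col M"
  have "(u \<in> carrier_vec ?n \<and> (binom u :: 'k mpoly) \<noteq> 0 \<and> (binom u :: 'k mpoly) \<in> toric_ideal M \<and>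
     \<not> (\<exists>v \<in> carrier_vec ?n. v \<noteq> u \<and>
          (binom v :: 'k mpoly) \<noteq> 0 \<and> (binom v :: 'k mpoly) \<in> toric_ideal M \<and>
          mono_dvd (pos_mono v) (pos_mono u) \<and> mono_dvd (pos_mono (- v)) (pos_mono (- u))))
     \<longleftrightarrow> primitive_vec M u" (is "?G u \<longleftrightarrow> _") for u
  proof (cases "u \<in> carrier_vec ?n")
    case True
    then have "dim_vec v = dim_vec u" if "v \<in> carrier_vec ?n" for v
      using that by simp
    then show ?thesis
      unfolding primitive_vec_def
      using True mat_kernel_dim[of _ M] binom_eq_0_iff[where 'k='k and n="?n"]
        binom_in_toric_ideal_iff[where 'k='k and M=M]
      by (auto simp: conformal_iff_dvd)
  next
    case False
    then show ?thesis
      using mat_kernel_dim[of u M] by (auto simp: primitive_vec_def)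
  qed
  then show ?thesis
    unfolding graver_def by auto
qed

lemma binom_in_graver_iff:
  assumes "u \<in> carrier_vec (dim_col M)"
  shows "(binom u :: 'k::field mpoly) \<in> graver M \<longleftrightarrow> primitive_vec M u"
proof
  assume "(binom u :: 'k mpoly) \<in> graver M"
  then obtain v where v: "primitive_vec M v" "(binom v :: 'k mpoly) = binom u"
    unfolding graver_eq by auto
  then have "u = v \<or> u = - v"
    using assms by (intro binom_eq_binom[of v "dim_col M" u, where 'k='k])
      (auto simp: primitive_vec_def mat_kernel_dim)
  then show "primitive_vec M u"
    using v(1) primitive_vec_uminus by blast
qed (auto simp: graver_eq)

text \<open>Why \<open>u\<close> is primitive: let \<open>v\<^sup>+\<close> and \<open>v\<^sup>-\<close> divide \<open>u\<^sup>+\<close> and \<open>u\<^sup>-\<close>, with \<open>v\<close> nonzero in the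
  kernel. The larger of \<open>v\<^sup>+\<close> and \<open>v\<^sup>-\<close> is nonstandard. It cannot be \<open>v\<^sup>-\<close>, because the divisors
  of the standard monomial \<open>u\<^sup>-\<close> are standard. So it is \<open>v\<^sup>+\<close>, which equals the minimal
  nonstandard monomial \<open>u\<^sup>+\<close>; then \<open>v\<^sup>-\<close> and \<open>u\<^sup>-\<close> are the standard monomial of one fibre.\<close>

lemma UGB_cases:
  assumes "(g :: 'k::field mpoly) \<in> UGB M"
  obtains u r where "g = binom u" "primitive_vec M u" "term_order (dim_col M) r"
    "pos_mono u \<in> minimal_nonstandard M r" "pos_mono (- u) \<notin> nonstandard M r"
proof -
  let ?n = "dim_col M"
  obtain r G where r: "term_order ?n r" and G: "reduced_groebner_basis ?n r (toric_ideal M) G" "g \<in> G"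
    using assms by (auto simp: UGB_def)
  obtain s t where st: "g = mono_poly s - mono_poly t" "same_fibre M s t"
      "s \<in> minimal_nonstandard M r" "t \<notin> nonstandard M r"
    using reduced_groebner_basis_element[OF r G] by blast
  have sN: "s \<in> nonstandard M r"
    and s_min: "\<And>v. v \<in> nonstandard M r \<Longrightarrow> mono_dvd v s \<Longrightarrow> v = s"
    using st(3) by (auto simp: minimal_nonstandard_def)
  have ts: "(t, s) \<in> r" "t \<noteq> s"
    using standard_le[OF r same_fibre_sym[OF st(2)] st(4)] st(4) sN by auto
  define u where "u = exp_diff ?n s t"
  have u: "u \<in> mat_kernel M"
    using st(2) by (simp add: same_fibre_iff_kernel u_def)
  note dim = mat_kernel_dim[OF u]
  have disj: "Poly_Mapping.lookup s i = 0 \<or> Poly_Mapping.lookup t i = 0" for i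
    using minimal_nonstandard_disjoint[OF r st(3) same_fibre_sym[OF st(2)] ts, of i] by auto
  note mon = same_fibre_monomials[OF st(2)]
  have s_eq: "pos_mono u = s"
  proof (rule poly_mapping_eqI)
    fix i show "Poly_Mapping.lookup (pos_mono u) i = Poly_Mapping.lookup s i"
      using disj[of i] monomials_lookup[OF mon(1), of i] by (auto simp: lookup_pos_mono u_def)
  qed
  have t_eq: "pos_mono (- u) = t"
  proof (rule poly_mapping_eqI)
    fix i show "Poly_Mapping.lookup (pos_mono (- u)) i = Poly_Mapping.lookup t i"
      using disj[of i] monomials_lookup[OF mon(2), of i] by (auto simp: lookup_pos_mono u_def)
  qed
  have "v = 0\<^sub>v ?n \<or> v = u" if v: "v \<in> mat_kernel M" "conformal v u" for v
  proof (rule disjCI)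
    assume "v \<noteq> u"
    note vdim = mat_kernel_dim[OF v(1)]
    have dvd: "mono_dvd (pos_mono v) s" "mono_dvd (pos_mono (- v)) t"
      using v(2) dim vdim conformal_iff_dvd[of v u] by (auto simp: s_eq t_eq)
    have fib: "same_fibre M (pos_mono v) (pos_mono (- v))"
      using v(1) vdim by (simp add: same_fibre_pos_mono)
    have std: "pos_mono (- v) \<notin> nonstandard M r"
      using nonstandard_dvd[OF r _ dvd(2) mon(2)] st(4) by blast
    show "v = 0\<^sub>v ?n"
    proof (cases "pos_mono v \<in> nonstandard M r")
      case True
      then have "pos_mono v = s"
        using s_min dvd(1) by blast
      then have "pos_mono (- v) = t"
        using fib st std standard_unique[OF r] same_fibre_trans same_fibre_sym by metis
      then have "v = u"
        using pos_mono_eq_iff[OF vdim dim] \<open>pos_mono v = s\<close> s_eq t_eq by simp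
      then show ?thesis using \<open>v \<noteq> u\<close> by blast
    next
      case False
      then have "pos_mono v = pos_mono (- v)"
        using standard_unique[OF r fib] std by blast
      then show ?thesis
        using pos_mono_neq[OF vdim] by blast
    qed
  qed
  moreover have "u \<noteq> 0\<^sub>v ?n"
    using ts(2) pos_mono_neq[OF dim] s_eq t_eq by auto
  ultimately have "primitive_vec M u"
    using u by (simp add: primitive_vec_def)
  moreover have "g = binom u"
    by (simp add: st(1) binom_def s_eq t_eq)
  ultimately show ?thesis
    using that r st(3,4) s_eq t_eq by blast
qed

lemma UGB_subset_graver: "(UGB M :: 'k::field mpoly set) \<subseteq> graver M"
  unfolding graver_eq by (auto elim: UGB_cases)

text \<open>The binomial is found by a term order that first compares the degree in the variables outside
  its support: \<open>u\<^sup>+\<close> and \<open>u\<^sup>-\<close> have degree \<open>0\<close>, and any smaller monomial \<open>w\<close> in their fibre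
  has no variable outside the support of \<open>u\<close> either. The hypothesis then makes \<open>u\<^sup>+ - w\<close> a
  vector of the kernel that is conformal to \<open>u\<close>, so that \<open>w\<close> is \<open>u\<^sup>+\<close> or \<open>u\<^sup>-\<close>: the segment between
  these two is an edge of the convex hull of the fibre.\<close>

lemma primitive_vec_UGB:
  assumes prim: "primitive_vec M u"
    and supp: "\<And>w i. same_fibre M w (pos_mono u) \<Longrightarrow>
       (\<And>j. j < dim_col M \<Longrightarrow> u $ j = 0 \<Longrightarrow> Poly_Mapping.lookup w j = 0) \<Longrightarrow>
       i < dim_col M \<Longrightarrow> int (Poly_Mapping.lookup w i) \<le> \<bar>u $ i\<bar>"
  shows "(binom u :: 'k::field mpoly) \<in> UGB M \<or> binom (- u) \<in> (UGB M :: 'k mpoly set)"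
proof -
  let ?n = "dim_col M" and ?a = "pos_mono u" and ?b = "pos_mono (- u)"
  define c :: "nat \<Rightarrow> nat" where "c i = (if u $ i = 0 then 1 else 0)" for i
  define r where "r = weight_order ?n c"
  have r: "term_order ?n r"
    unfolding r_def by (rule term_order_weight_order)
  have u: "u \<in> mat_kernel M" "u \<noteq> 0\<^sub>v ?n"
    using prim by (auto simp: primitive_vec_def)
  note dim = mat_kernel_dim[OF u(1)]
  have fib: "same_fibre M ?a ?b"
    using u(1) dim by (simp add: same_fibre_pos_mono)
  have wt0: "weight ?n c ?a = 0" "weight ?n c ?b = 0"
    using dim by (auto simp: weight_def c_def lookup_pos_mono)
  have only: "w = ?a \<or> w = ?b" if w: "same_fibre M w ?a" "weight ?n c w = 0" for w
  proof -
    have z: "Poly_Mapping.lookup w j = 0" if "j < ?n" "u $ j = 0" for j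
    proof -
      have "c j * Poly_Mapping.lookup w j = 0"
        using w(2) that(1) by (simp add: weight_def)
      then show ?thesis
        using that(2) by (simp add: c_def)
    qed
    note le = supp[OF w(1) z]
    define v where "v = exp_diff ?n ?a w"
    have v: "v \<in> mat_kernel M"
      using same_fibre_sym[OF w(1)] by (simp add: same_fibre_iff_kernel v_def)
    have "conformal v u"
      unfolding conformal_def
    proof (intro allI impI)
      fix i assume "i < dim_vec u"
      then have i: "i < ?n" using dim by simp
      have "v $ i = int (nat (u $ i)) - int (Poly_Mapping.lookup w i)"
        using i dim by (simp add: v_def lookup_pos_mono)
      moreover have "int (Poly_Mapping.lookup w i) \<le> \<bar>u $ i\<bar>"
        using le i by simp
      ultimately show "0 \<le> v $ i \<and> v $ i \<le> u $ i \<or> u $ i \<le> v $ i \<and> v $ i \<le> 0"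
        by linarith
    qed
    then have "v = 0\<^sub>v ?n \<or> v = u"
      using prim v by (simp add: primitive_vec_def)
    then show ?thesis
    proof
      assume v0: "v = 0\<^sub>v ?n"
      have "w = ?a"
      proof (rule monomials_eqI)
        fix i assume "i < ?n"
        then show "Poly_Mapping.lookup w i = Poly_Mapping.lookup ?a i"
          using arg_cong[OF v0, of "\<lambda>x. x $ i"] by (simp add: v_def)
      qed (use same_fibre_monomials[OF w(1)] in auto)
      then show ?thesis ..
    next
      assume vu: "v = u"
      have "w = ?b"
      proof (rule monomials_eqI)
        fix i assume "i < ?n"
        then show "Poly_Mapping.lookup w i = Poly_Mapping.lookup ?b i"
          using arg_cong[OF vu, of "\<lambda>x. x $ i"] dim
          by (auto simp: v_def lookup_pos_mono split: if_splits)
      qed (use same_fibre_monomials[OF w(1)] same_fibre_monomials[OF fib] in auto)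
      then show ?thesis ..
    qed
  qed
  obtain G :: "'k mpoly set" where G: "reduced_groebner_basis ?n r (toric_ideal M) G"
    using reduced_groebner_basis_exists[OF r] by blast
  have GU: "G \<subseteq> UGB M"
    using G r by (auto simp: UGB_def)
  have key: "mono_poly a - mono_poly b \<in> G"
    if ab: "{a, b} = {?a, ?b}" "a \<noteq> b" "(b, a) \<in> r" for a b
  proof -
    have fab: "same_fibre M a ?a" "same_fibre M b a" and a0: "weight ?n c a = 0"
      using ab(1) fib same_fibre_sym same_fibre_refl same_fibre_monomials wt0
      by (auto simp: doubleton_eq_iff)
    have disj: "Poly_Mapping.lookup a i = 0 \<or> Poly_Mapping.lookup b i = 0" for i
      using ab(1) by (auto simp: doubleton_eq_iff lookup_pos_mono)
    have aN: "a \<in> nonstandard M r"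
      using fab(2) ab(2,3) by (auto simp: nonstandard_def)
    obtain g where g: "g \<in> G" "mono_dvd (lead_mono r g) a"
      using reduced_groebner_basis_divisor[OF r G aN] by blast
    obtain s t where st: "g = mono_poly s - mono_poly t" "same_fibre M s t"
        "s \<in> minimal_nonstandard M r" "t \<notin> nonstandard M r"
      using reduced_groebner_basis_element[OF r G g(1)] by blast
    have sN: "s \<in> nonstandard M r"
      using st(3) by (simp add: minimal_nonstandard_def)
    have ts: "(t, s) \<in> r" "t \<noteq> s"
      using standard_le[OF r same_fibre_sym[OF st(2)] st(4)] st(4) sN by auto
    have "lead_mono r g = s"
      unfolding st(1) using ts same_fibre_monomials(1)[OF st(2)] by (intro lead_binomial[OF r])
    then obtain m where m: "a = s + m"
      using g(2) unfolding mono_dvd_def by blast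
    have mm: "m \<in> monomials ?n"
      using m same_fibre_monomials(1)[OF fab(1)] monomials_add_iff by metis
    have lt: "(t + m, a) \<in> r" "t + m \<noteq> a"
      using term_order_add[OF r ts(1) mm] ts(2) m by auto
    have "same_fibre M (t + m) ?a"
      using fab(1) st(2) m mm same_fibre_add_iff same_fibre_sym same_fibre_trans by metis
    moreover have "weight ?n c (t + m) = 0"
      using lt(1) a0 by (simp add: r_def weight_order_def)
    ultimately have "t + m = b"
      using only lt(2) ab(1,2) by (metis insertE insertI1 singletonD insert_iff)
    then have "m = 0"
      using m disj by (intro poly_mapping_eqI) (metis add_is_0 lookup_add lookup_zero)
    then show ?thesis
      using g(1) st(1) m \<open>t + m = b\<close> by simp
  qed
  have "?a \<noteq> ?b"
    using pos_mono_neq[OF dim] u(2) by simp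
  moreover have "(?b, ?a) \<in> r \<or> (?a, ?b) \<in> r"
    using term_order_total[OF r] same_fibre_monomials[OF fib] by blast
  ultimately have "mono_poly ?a - mono_poly ?b \<in> G \<or> mono_poly ?b - mono_poly ?a \<in> G"
    using key[of ?a ?b] key[of ?b ?a] by (metis insert_commute)
  then show ?thesis
    using GU by (auto simp: binom_def)
qed

text \<open>In the opposite direction, the two monomials of an element of the universal Groebner basis
  are vertices of the convex hull of their fibre. If \<open>a\<close> were the midpoint of \<open>w\<^sub>1\<close> and \<open>w\<^sub>2\<close>, one
  of these would be smaller than \<open>a\<close>; this is impossible if \<open>a\<close> is the standard monomial of its
  fibre, and, as \<open>a\<close> shares a variable with both, also if \<open>a\<close> is a minimal nonstandard one.\<close>

lemma not_UGB_midpoint: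
  assumes w: "same_fibre M w1 (pos_mono u)" "same_fibre M w2 (pos_mono u)"
    and mid: "w1 + w2 = pos_mono u + pos_mono u" and neq: "w1 \<noteq> pos_mono u" "w1 \<noteq> 0" "w2 \<noteq> 0"
    and u: "u \<in> carrier_vec (dim_col M)" "u \<noteq> 0\<^sub>v (dim_col M)"
  shows "(binom u :: 'k::field mpoly) \<notin> up_to_sign (UGB M)"
proof
  assume "(binom u :: 'k mpoly) \<in> up_to_sign (UGB M)"
  then have "(binom u :: 'k mpoly) \<in> UGB M \<or> (\<exists>g\<in>UGB M. (binom u :: 'k mpoly) = - g)"
    by (auto simp: up_to_sign_def)
  then obtain g :: "'k mpoly" where g: "g \<in> UGB M" "g = binom u \<or> g = binom (- u)"
    by (auto simp: binom_uminus)
  obtain v r where v: "g = binom v" "primitive_vec M v" and r: "term_order (dim_col M) r"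
      and vs: "pos_mono v \<in> minimal_nonstandard M r" "pos_mono (- v) \<notin> nonstandard M r"
    using g(1) by (rule UGB_cases)
  have "v = u \<or> v = - u"
  proof -
    have vdim: "v \<in> carrier_vec (dim_col M)"
      using v(2) by (simp add: primitive_vec_def mat_kernel_dim)
    have "- u \<noteq> 0\<^sub>v (dim_col M)"
    proof
      assume "- u = 0\<^sub>v (dim_col M)"
      then have "- (- u) = - 0\<^sub>v (dim_col M)" by (simp only:)
      then show False using u(2) by simp
    qed
    moreover have "- (- u) = u" by simp
    ultimately show ?thesis
      using g(2) binom_eq_binom[OF u(1) vdim u(2), where 'k='k]
        binom_eq_binom[of "- u" "dim_col M" v, where 'k='k] u(1) vdim v(1) by auto
  qed
  then have a: "pos_mono u \<in> minimal_nonstandard M r \<or> pos_mono u \<notin> nonstandard M r"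
    using vs by auto
  let ?a = "pos_mono u"
  have gt: "(?a, w) \<in> r" if wa: "same_fibre M w ?a" "w + w' = ?a + ?a" "w \<noteq> 0" for w w'
  proof (rule ccontr)
    assume "(?a, w) \<notin> r"
    then have lt: "(w, ?a) \<in> r" "w \<noteq> ?a"
      using term_order_total[OF r same_fibre_monomials[OF wa(1)]]
        term_order_refl[OF r same_fibre_monomials(1)[OF wa(1)]] by auto
    then have "?a \<in> nonstandard M r"
      using wa(1) unfolding nonstandard_def by blast
    then have a_min: "?a \<in> minimal_nonstandard M r"
      using a by blast
    obtain i where i: "Poly_Mapping.lookup w i \<noteq> 0"
      using wa(3) by (metis lookup_zero poly_mapping_eqI)
    have "Poly_Mapping.lookup w i + Poly_Mapping.lookup w' i
        = Poly_Mapping.lookup ?a i + Poly_Mapping.lookup ?a i"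
      using arg_cong[OF wa(2), of "\<lambda>s. Poly_Mapping.lookup s i"] by (simp add: lookup_add)
    then have "Poly_Mapping.lookup ?a i \<noteq> 0"
      using i by linarith
    then show False
      using minimal_nonstandard_disjoint[OF r a_min wa(1) lt, of i] i by simp
  qed
  have "(?a + ?a, w1 + ?a) \<in> r"
    using gt[OF w(1) mid neq(2)] same_fibre_monomials(2)[OF w(1)] by (rule term_order_add[OF r])
  moreover have "(?a + w1, w2 + w1) \<in> r"
    using gt[OF w(2) _ neq(3), of w1] mid same_fibre_monomials(1)[OF w(1)]
    by (intro term_order_add[OF r]) (simp_all add: add.commute)
  then have "(w1 + ?a, ?a + ?a) \<in> r"
    using mid by (simp add: add.commute)
  ultimately have "?a + ?a = w1 + ?a"
    by (rule term_order_antisym[OF r])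
  then show False using neq(1) by simp
qed


section \<open>N-fold matrices over a row of ones\<close>

definition ones_row :: "nat \<Rightarrow> int mat" where
  "ones_row n = mat 1 n (\<lambda>_. 1)"

definition norm1 :: "int vec \<Rightarrow> int" where
  "norm1 u = (\<Sum>k<dim_vec u. \<bar>u $ k\<bar>)"

text \<open>The degree of \<open>u\<^sup>+\<close> in the variables of block \<open>b\<close>.\<close>

definition block_degree :: "nat \<Rightarrow> int vec \<Rightarrow> nat \<Rightarrow> int" where
  "block_degree n u b = (\<Sum>k<dim_vec u. of_bool (k div n = b) * max 0 (u $ k))"

lemma dim_ones_row [simp]: "dim_row (ones_row n) = 1" "dim_col (ones_row n) = n"
  by (simp_all add: ones_row_def)

lemma dim_nfold [simp]:
  "dim_row (nfold A B N) = dim_row B + N * dim_row A" "dim_col (nfold A B N) = N * dim_col A"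
  by (simp_all add: nfold_def)

context
  fixes n :: nat and B :: "int mat"
  assumes n: "0 < n"
begin

lemma kernel_nfold_iff:
  "u \<in> mat_kernel (nfold (ones_row n) B N) \<longleftrightarrow> u \<in> carrier_vec (N * n) \<and>
     (\<forall>i<dim_row B. (\<Sum>k<N * n. B $$ (i, k mod n) * u $ k) = 0) \<and>
     (\<forall>b<N. (\<Sum>k<N * n. of_bool (k div n = b) * u $ k) = 0)"
proof -
  let ?M = "nfold (ones_row n) B N" and ?d = "dim_row B"
  have split: "(\<forall>i<?d + N. P i) \<longleftrightarrow> (\<forall>i<?d. P i) \<and> (\<forall>b<N. P (?d + b))" for P
  proof
    assume *: "(\<forall>i<?d. P i) \<and> (\<forall>b<N. P (?d + b))"
    show "\<forall>i<?d + N. P i"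
    proof (intro allI impI)
      fix i assume "i < ?d + N"
      then show "P i"
        using * spec[of _ "i - ?d"] by (cases "i < ?d") (auto dest: spec[of _ "i - ?d"])
    qed
  qed auto
  have "(\<Sum>k<N * n. ?M $$ (i, k) * u $ k) = (\<Sum>k<N * n. B $$ (i, k mod n) * u $ k)"
    if "i < ?d" for i
    using that by (intro sum.cong) (auto simp: nfold_def)
  moreover have "(\<Sum>k<N * n. ?M $$ (?d + b, k) * u $ k) = (\<Sum>k<N * n. of_bool (k div n = b) * u $ k)"
    if "b < N" for b
    using that n by (intro sum.cong) (auto simp: nfold_def ones_row_def)
  ultimately show ?thesis
    by (simp add: mat_kernel_iff split)
qed

text \<open>If \<open>u\<^sup>+\<close> has degree at most \<open>1\<close> in each block, then so has every monomial of its fibre. Hence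
  such a monomial has exponents at most \<open>1\<close>, and it satisfies the edge criterion.\<close>

lemma UGB_of_block_degree_le_1:
  assumes prim: "primitive_vec (nfold (ones_row n) B N) u"
    and deg: "\<And>b. b < N \<Longrightarrow> block_degree n u b \<le> 1"
  shows "(binom u :: 'k::field mpoly) \<in> UGB (nfold (ones_row n) B N) \<or>
    binom (- u) \<in> (UGB (nfold (ones_row n) B N) :: 'k mpoly set)"
proof (rule primitive_vec_UGB[OF prim])
  let ?M = "nfold (ones_row n) B N"
  fix w i
  assume fib: "same_fibre ?M w (pos_mono u)"
    and supp: "\<And>j. j < dim_col ?M \<Longrightarrow> u $ j = 0 \<Longrightarrow> Poly_Mapping.lookup w j = 0"
    and i: "i < dim_col ?M"
  define b where "b = i div n"
  have iN: "i < N * n" using i by simp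
  then have b: "b < N" unfolding b_def by (rule less_mult_imp_div_less)
  have dim: "dim_vec u = N * n"
    using prim by (simp add: primitive_vec_def mat_kernel_def)
  have "exp_diff (N * n) w (pos_mono u) \<in> mat_kernel ?M"
    using fib by (simp add: same_fibre_iff_kernel)
  then have "(\<Sum>k<N * n. of_bool (k div n = b) * exp_diff (N * n) w (pos_mono u) $ k) = 0"
    using b unfolding kernel_nfold_iff by blast
  then have "(\<Sum>k<N * n. of_bool (k div n = b) * int (Poly_Mapping.lookup w k))
      = (\<Sum>k<N * n. of_bool (k div n = b) * int (Poly_Mapping.lookup (pos_mono u) k))"
    by (simp add: right_diff_distrib sum_subtractf)
  also have "\<dots> = block_degree n u b"
    unfolding block_degree_def dim by (intro sum.cong) (auto simp: lookup_pos_mono dim)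
  finally have sum: "(\<Sum>k<N * n. of_bool (k div n = b) * int (Poly_Mapping.lookup w k)) \<le> 1"
    using deg[OF b] by simp
  have "of_bool (i div n = b) * int (Poly_Mapping.lookup w i)
      \<le> (\<Sum>k<N * n. of_bool (k div n = b) * int (Poly_Mapping.lookup w k))"
    using iN by (intro member_le_sum) auto
  then have "int (Poly_Mapping.lookup w i) \<le> 1"
    using sum by (simp add: b_def)
  then show "int (Poly_Mapping.lookup w i) \<le> \<bar>u $ i\<bar>"
    using supp[OF i] by (cases "u $ i = 0") auto
qed

text \<open>A block in which \<open>u\<^sup>+\<close> has degree at least \<open>2\<close> has room for splitting off a difference of two
  unit vectors, which is moved to a new block. A vector conformal to the result becomes conformal
  to \<open>u\<close> when the new block is added back to the old one, so the result is primitive again.\<close>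

lemma split_block:
  assumes prim: "primitive_vec (nfold (ones_row n) B N) u"
    and b: "b < N" "block_degree n u b > 1"
  shows "\<exists>u'. primitive_vec (nfold (ones_row n) B (Suc N)) u' \<and> norm1 u' = norm1 u \<and>
    block_type n N u < block_type n (Suc N) u'"
proof -
  let ?m = "N * n" and ?m' = "Suc N * n"
  have u: "u \<in> mat_kernel (nfold (ones_row n) B N)"
    and min: "\<And>v. v \<in> mat_kernel (nfold (ones_row n) B N) \<Longrightarrow> conformal v u \<Longrightarrow> v = 0\<^sub>v ?m \<or> v = u"
    using prim by (auto simp: primitive_vec_def)
  have dim: "dim_vec u = ?m" and kerB: "\<And>i. i < dim_row B \<Longrightarrow> (\<Sum>k<?m. B $$ (i, k mod n) * u $ k) = 0"
    and ker1: "\<And>c. c < N \<Longrightarrow> (\<Sum>k<?m. of_bool (k div n = c) * u $ k) = 0"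
    using u by (auto simp: kernel_nfold_iff)
  have "\<exists>p<?m. p div n = b \<and> u $ p > 0"
  proof (rule ccontr)
    assume "\<not> ?thesis"
    then have "of_bool (k div n = b) * max 0 (u $ k) = 0" if "k < ?m" for k
      using that by force
    then show False using b(2) by (simp add: block_degree_def dim)
  qed
  then obtain p where p: "p < ?m" "p div n = b" "u $ p > 0" by blast
  have "\<exists>q<?m. q div n = b \<and> u $ q < 0"
  proof (rule ccontr)
    assume "\<not> ?thesis"
    then have "\<forall>k\<in>{..<?m}. 0 \<le> of_bool (k div n = b) * u $ k" by force
    then have "of_bool (p div n = b) * u $ p \<le> (\<Sum>k<?m. of_bool (k div n = b) * u $ k)"
      using p(1) by (intro member_le_sum) auto
    then show False using p ker1[OF b(1)] by simp
  qed
  then obtain q where q: "q < ?m" "q div n = b" "u $ q < 0" by blast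
  define P Q where "P = ?m + p mod n" and "Q = ?m + q mod n"
  have pq: "p \<noteq> q" using p q by auto
  then have "p mod n \<noteq> q mod n"
    using p(2) q(2) div_mult_mod_eq by metis
  then have PQ: "P \<noteq> Q" "?m \<le> P" "?m \<le> Q" "P < ?m'" "Q < ?m'"
    using n by (auto simp: P_def Q_def)
  have mod: "P mod n = p mod n" "Q mod n = q mod n" and dv: "P div n = N" "Q div n = N"
    using n by (auto simp: P_def Q_def)
  have new_block: "k div n = N" if "?m \<le> k" "k < ?m'" for k
    using that n by (metis div_nat_eqI mult.commute)
  have old_block: "k div n < N" if "k < ?m" for k
    using that by (rule less_mult_imp_div_less)
  \<comment> \<open>\<open>e\<^sub>p - e\<^sub>q\<close> is subtracted in block \<open>b\<close>, and its copy \<open>e\<^sub>P - e\<^sub>Q\<close> forms block \<open>N\<close>.\<close>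
  define u' where "u' = vec ?m' (\<lambda>k. if k < ?m then u $ k - of_bool (k = p) + of_bool (k = q)
    else of_bool (k = P) - of_bool (k = Q))"
  have dim': "dim_vec u' = ?m'" by (simp add: u'_def)
  have u'_old: "u' $ k = u $ k - of_bool (k = p) + of_bool (k = q)" if "k < ?m" for k
    using that by (simp add: u'_def)
  have u'_new: "u' $ k = of_bool (k = P) - of_bool (k = Q)" if "?m \<le> k" "k < ?m'" for k
    using that by (simp add: u'_def)
  have sum_split: "(\<Sum>k<?m'. G k) = (\<Sum>k<?m. G k) + G P + G Q"
    if "\<And>k. ?m \<le> k \<Longrightarrow> k < ?m' \<Longrightarrow> k \<noteq> P \<Longrightarrow> k \<noteq> Q \<Longrightarrow> G k = 0" for G :: "nat \<Rightarrow> int"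
  proof -
    have "(\<Sum>k<?m'. G k) = (\<Sum>k\<in>{..<?m} \<union> {P, Q}. G k)"
      using PQ that by (intro sum.mono_neutral_right) auto
    also have "\<dots> = (\<Sum>k<?m. G k) + (\<Sum>k\<in>{P, Q}. G k)"
      using PQ by (intro sum.union_disjoint) auto
    finally show ?thesis using PQ(1) by simp
  qed
  have sum_u': "(\<Sum>k<?m'. F k * u' $ k) = (\<Sum>k<?m. F k * u $ k) - F p + F q + F P - F Q"
    for F :: "nat \<Rightarrow> int"
  proof -
    have "(\<Sum>k<?m. F k * u' $ k)
        = (\<Sum>k<?m. F k * u $ k - (if k = p then F p else 0) + (if k = q then F q else 0))"
      by (intro sum.cong) (auto simp: u'_old algebra_simps)
    also have "\<dots> = (\<Sum>k<?m. F k * u $ k) - F p + F q"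
      using p(1) q(1) by (simp add: sum.distrib sum_subtractf)
    finally show ?thesis
      using PQ sum_split[of "\<lambda>k. F k * u' $ k"] by (simp add: u'_new)
  qed
  have ker': "u' \<in> mat_kernel (nfold (ones_row n) B (Suc N))"
    unfolding kernel_nfold_iff
  proof (intro conjI allI impI)
    show "u' \<in> carrier_vec ?m'"
      using dim' by (rule carrier_vecI)
    show "(\<Sum>k<?m'. B $$ (i, k mod n) * u' $ k) = 0" if "i < dim_row B" for i
      unfolding sum_u' mod using kerB[OF that] by simp
    fix c assume "c < Suc N"
    moreover have "(\<Sum>k<?m. of_bool (k div n = N) * u $ k) = 0"
      using old_block by (intro sum.neutral) auto
    ultimately show "(\<Sum>k<?m'. of_bool (k div n = c) * u' $ k) = 0"
      using ker1 unfolding sum_u' by (cases "c = N") (auto simp: p(2) q(2) dv)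
  qed
  have prim': "v = 0\<^sub>v ?m' \<or> v = u'"
    if v: "v \<in> mat_kernel (nfold (ones_row n) B (Suc N))" "conformal v u'" for v
  proof -
    have vdim: "dim_vec v = ?m'"
      and vB: "\<And>i. i < dim_row B \<Longrightarrow> (\<Sum>k<?m'. B $$ (i, k mod n) * v $ k) = 0"
      and v1: "\<And>c. c < Suc N \<Longrightarrow> (\<Sum>k<?m'. of_bool (k div n = c) * v $ k) = 0"
      using v(1) by (auto simp: kernel_nfold_iff)
    have conf: "0 \<le> v $ k \<and> v $ k \<le> u' $ k \<or> u' $ k \<le> v $ k \<and> v $ k \<le> 0" if "k < ?m'" for k
      using v(2) that by (simp add: conformal_def dim')
    have m_less: "k < ?m'" if "k < ?m" for k using that by simp
    have v_new: "v $ k = 0" if "?m \<le> k" "k < ?m'" "k \<noteq> P" "k \<noteq> Q" for k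
      using conf[OF that(2)] u'_new[OF that(1,2)] that(3,4) by auto
    have vP: "0 \<le> v $ P" "v $ P \<le> 1" and vQ: "- 1 \<le> v $ Q" "v $ Q \<le> 0"
      using conf[of P] conf[of Q] u'_new[of P] u'_new[of Q] PQ by auto
    have vp: "0 \<le> v $ p" "v $ p \<le> u $ p - 1"
      using conf[OF m_less[OF p(1)]] u'_old[OF p(1)] p(3) pq by auto
    have vq: "u $ q + 1 \<le> v $ q" "v $ q \<le> 0"
      using conf[OF m_less[OF q(1)]] u'_old[OF q(1)] q(3) pq by auto
    \<comment> \<open>Block \<open>N\<close> of \<open>v\<close> is folded back onto block \<open>b\<close>.\<close>
    define w where "w = vec ?m (\<lambda>k. v $ k + of_bool (k = p) * v $ P + of_bool (k = q) * v $ Q)"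
    have w: "w $ k = v $ k + of_bool (k = p) * v $ P + of_bool (k = q) * v $ Q" if "k < ?m" for k
      using that by (simp add: w_def)
    have sum_w: "(\<Sum>k<?m. F k * w $ k)
        = (\<Sum>k<?m'. F k * v $ k) + (F p - F P) * v $ P + (F q - F Q) * v $ Q" for F :: "nat \<Rightarrow> int"
    proof -
      have "(\<Sum>k<?m. F k * w $ k)
          = (\<Sum>k<?m. F k * v $ k + (if k = p then F p * v $ P else 0) + (if k = q then F q * v $ Q else 0))"
        by (intro sum.cong) (auto simp: w algebra_simps)
      also have "\<dots> = (\<Sum>k<?m. F k * v $ k) + F p * v $ P + F q * v $ Q"
        using p(1) q(1) by (simp add: sum.distrib)
      finally show ?thesis
        using sum_split[of "\<lambda>k. F k * v $ k"] v_new by (simp add: algebra_simps)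
    qed
    have PQ0: "v $ P + v $ Q = 0"
    proof -
      have "(\<Sum>k<?m. of_bool (k div n = N) * v $ k) = 0"
        using old_block by (intro sum.neutral) auto
      then show ?thesis
        using v1[of N] sum_split[of "\<lambda>k. of_bool (k div n = N) * v $ k"] v_new dv by simp
    qed
    have "w \<in> mat_kernel (nfold (ones_row n) B N)"
      unfolding kernel_nfold_iff
    proof (intro conjI allI impI)
      show "w \<in> carrier_vec ?m"
        by (simp add: w_def)
      show "(\<Sum>k<?m. B $$ (i, k mod n) * w $ k) = 0" if "i < dim_row B" for i
        unfolding sum_w mod using vB[OF that] by simp
      fix c assume "c < N"
      then show "(\<Sum>k<?m. of_bool (k div n = c) * w $ k) = 0"
        using v1[of c] PQ0 by (simp add: sum_w p(2) q(2) dv distrib_left[symmetric])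
    qed
    moreover have "conformal w u"
      unfolding conformal_def
    proof (intro allI impI)
      fix k assume "k < dim_vec u"
      then have k: "k < ?m" using dim by simp
      consider "k = p" | "k = q" | "k \<noteq> p" "k \<noteq> q" by blast
      then show "0 \<le> w $ k \<and> w $ k \<le> u $ k \<or> u $ k \<le> w $ k \<and> w $ k \<le> 0"
      proof cases
        case 1 then show ?thesis using w[OF k] vp vP pq by simp
      next
        case 2 then show ?thesis using w[OF k] vq vQ pq by simp
      next
        case 3 then show ?thesis using w[OF k] conf[OF m_less[OF k]] u'_old[OF k] by simp
      qed
    qed
    ultimately have "w = 0\<^sub>v ?m \<or> w = u"
      by (rule min)
    then show ?thesis
    proof
      assume "w = 0\<^sub>v ?m"
      then have w0: "w $ k = 0" if "k < ?m" for k using that by simp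
      have "v $ p = 0" "v $ P = 0" "v $ q = 0" "v $ Q = 0"
        using w0[OF p(1)] w0[OF q(1)] w[OF p(1)] w[OF q(1)] pq vp vP vq vQ by auto
      have "v $ k = 0" if "k < ?m'" for k
        using w0[of k] w[of k] v_new[of k] that \<open>v $ p = 0\<close> \<open>v $ P = 0\<close> \<open>v $ q = 0\<close> \<open>v $ Q = 0\<close>
        by (cases "k < ?m"; cases "k = p"; cases "k = q"; cases "k = P"; cases "k = Q") auto
      then have "v = 0\<^sub>v ?m'"
        using vdim by (intro eq_vecI) auto
      then show ?thesis ..
    next
      assume wu: "w = u"
      have wp: "w $ p = v $ p + v $ P" and wq: "w $ q = v $ q + v $ Q"
        using w[OF p(1)] w[OF q(1)] pq by auto
      then have vv: "v $ P = 1" "v $ p = u $ p - 1" "v $ Q = - 1" "v $ q = u $ q + 1"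
        using vp vP vq vQ unfolding wu by linarith+
      have "v $ k = u' $ k" if k: "k < ?m'" for k
      proof (cases "k < ?m")
        case True
        then show ?thesis
          using w[OF True] u'_old[OF True] vv pq unfolding wu by auto
      next
        case False
        then show ?thesis
          using v_new[of k] u'_new[of k] k vv PQ(1) by auto
      qed
      then have "v = u'"
        using vdim dim' by (intro eq_vecI) auto
      then show ?thesis ..
    qed
  qed
  have "u' $ P = 1" using u'_new[of P] PQ by simp
  then have "u' \<noteq> 0\<^sub>v ?m'" using PQ(4) by auto
  then have primitive: "primitive_vec (nfold (ones_row n) B (Suc N)) u'"
    using ker' prim' by (simp add: primitive_vec_def)
  have "(\<Sum>k<?m. \<bar>u' $ k\<bar>)
      = (\<Sum>k<?m. \<bar>u $ k\<bar> - (if k = p then 1 else 0) - (if k = q then 1 else 0))"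
    using p(3) q(3) pq by (intro sum.cong) (auto simp: u'_old)
  also have "\<dots> = (\<Sum>k<?m. \<bar>u $ k\<bar>) - 2"
    using p(1) q(1) by (simp add: sum_subtractf)
  finally have norm: "norm1 u' = norm1 u"
    using sum_split[of "\<lambda>k. \<bar>u' $ k\<bar>"] PQ by (simp add: norm1_def dim dim' u'_new)
  define T where "T = {c. c < N \<and> (\<exists>j<n. u $ (c * n + j) \<noteq> 0)}"
  have pos_less: "c * n + j < ?m" if "c < N" "j < n" for c j
  proof -
    have "Suc c * n \<le> N * n" using that(1) by (intro mult_le_mono1) simp
    then show ?thesis using that(2) by simp
  qed
  have block_b: "\<exists>j<n. u' $ (b * n + j) \<noteq> 0"
  proof (rule ccontr)
    assume no: "\<not> ?thesis"
    have z: "u' $ k = 0" if "k < ?m" "k div n = b" for k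
    proof -
      have "k = b * n + k mod n" using that(2) by (metis div_mult_mod_eq)
      then show ?thesis using no n by (metis mod_less_divisor)
    qed
    have "of_bool (k div n = b) * max 0 (u $ k) \<le> (if k = p then 1 else 0)" if "k < ?m" for k
    proof (cases "k div n = b")
      case True
      then have "u $ k = of_bool (k = p) - of_bool (k = q)"
        using z[OF that True] u'_old[OF that] by simp
      then show ?thesis by (cases "k = q") auto
    qed simp
    then have "block_degree n u b \<le> (\<Sum>k<?m. if k = p then 1 else 0)"
      unfolding block_degree_def dim by (intro sum_mono) auto
    then show False using b(2) p(1) by simp
  qed
  have "u' $ (c * n + j) \<noteq> 0" if "c < N" "j < n" "u $ (c * n + j) \<noteq> 0" "c \<noteq> b" for c j
  proof -
    have "(c * n + j) div n = c" using that(2) by simp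
    then have "c * n + j \<noteq> p" "c * n + j \<noteq> q" using that(4) p(2) q(2) by auto
    then show ?thesis using that(3) u'_old[OF pos_less[OF that(1,2)]] by simp
  qed
  then have "c \<in> {c. c < Suc N \<and> (\<exists>j<n. u' $ (c * n + j) \<noteq> 0)}" if "c \<in> T" for c
    using that block_b unfolding T_def by (cases "c = b") auto
  moreover have "\<exists>j<n. u' $ (N * n + j) \<noteq> 0"
    using \<open>u' $ P = 1\<close> n by (intro exI[of _ "p mod n"]) (simp add: P_def)
  ultimately have "insert N T \<subseteq> {c. c < Suc N \<and> (\<exists>j<n. u' $ (c * n + j) \<noteq> 0)}"
    by auto
  then have "card (insert N T) \<le> block_type n (Suc N) u'"
    unfolding block_type_def by (intro card_mono) auto
  moreover have "card (insert N T) = Suc (block_type n N u)"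
    by (simp add: T_def block_type_def)
  ultimately show ?thesis
    using primitive norm by auto
qed

lemma block_type_le_norm1:
  assumes "dim_vec u = N * n"
  shows "int (block_type n N u) \<le> norm1 u"
proof -
  let ?K = "{k. k < N * n \<and> u $ k \<noteq> 0}"
  have "{b. b < N \<and> (\<exists>j<n. u $ (b * n + j) \<noteq> 0)} \<subseteq> (\<lambda>k. k div n) ` ?K"
  proof
    fix b assume "b \<in> {b. b < N \<and> (\<exists>j<n. u $ (b * n + j) \<noteq> 0)}"
    then obtain j where j: "b < N" "j < n" "u $ (b * n + j) \<noteq> 0" by blast
    have "Suc b * n \<le> N * n" using j(1) by (intro mult_le_mono1) simp
    then show "b \<in> (\<lambda>k. k div n) ` ?K"
      using j by (intro image_eqI[of _ _ "b * n + j"]) auto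
  qed
  then have "block_type n N u \<le> card ?K"
    unfolding block_type_def by (rule surj_card_le[rotated]) simp
  also have "int (card ?K) = (\<Sum>k\<in>?K. 1)" by simp
  also have "\<dots> \<le> (\<Sum>k\<in>?K. \<bar>u $ k\<bar>)" by (intro sum_mono) auto
  also have "\<dots> \<le> norm1 u"
    unfolding norm1_def assms by (intro sum_mono2) auto
  finally show ?thesis by simp
qed

text \<open>Splitting preserves the norm, which bounds the type, so it ends; then the edge criterion
  applies.\<close>

lemma UGB_of_larger_type:
  assumes "primitive_vec (nfold (ones_row n) B N) u"
  shows "\<exists>N'\<ge>N. \<exists>v \<in> carrier_vec (N' * n). block_type n N u \<le> block_type n N' v \<and>
    (binom v :: 'k::field mpoly) \<in> UGB (nfold (ones_row n) B N')"
  using assms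
proof (induction "nat (norm1 u - int (block_type n N u))" arbitrary: N u rule: less_induct)
  case less
  have dim: "u \<in> carrier_vec (N * n)"
    using less.prems by (simp add: primitive_vec_def mat_kernel_def)
  show ?case
  proof (cases "\<exists>b<N. block_degree n u b > 1")
    case True
    then obtain u' where u': "primitive_vec (nfold (ones_row n) B (Suc N)) u'" "norm1 u' = norm1 u"
        "block_type n N u < block_type n (Suc N) u'"
      using split_block[OF less.prems] by blast
    have "dim_vec u' = Suc N * n"
      using u'(1) by (simp add: primitive_vec_def mat_kernel_def)
    then have "int (block_type n (Suc N) u') \<le> norm1 u'"
      by (rule block_type_le_norm1)
    then have "nat (norm1 u' - int (block_type n (Suc N) u')) < nat (norm1 u - int (block_type n N u))"
      using u'(2,3) by linarith
    from less.hyps[OF this u'(1)] show ?thesis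
      using u'(3) by (meson Suc_leD less_imp_le order_trans)
  next
    case False
    then have "(binom u :: 'k mpoly) \<in> UGB (nfold (ones_row n) B N) \<or>
        binom (- u) \<in> (UGB (nfold (ones_row n) B N) :: 'k mpoly set)"
      by (intro UGB_of_block_degree_le_1[OF less.prems]) (meson not_less)
    moreover have "block_type n N (- u) = block_type n N u"
    proof -
      have "(- u) $ (b * n + j) \<noteq> 0 \<longleftrightarrow> u $ (b * n + j) \<noteq> 0" if "b < N" "j < n" for b j
      proof -
        have "Suc b * n \<le> N * n" using that(1) by (intro mult_le_mono1) simp
        then show ?thesis using that(2) dim by simp
      qed
      then show ?thesis
        unfolding block_type_def by (intro arg_cong[where f=card]) blast
    qed
    ultimately show ?thesis
      using dim by (intro exI[of _ N]) (auto intro: bexI[of _ u] bexI[of _ "- u"])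
  qed
qed

text \<open>The converse inequality needs a Groebner basis element only of type at least that of a given
  Graver basis element, possibly with more blocks.\<close>

lemma groebner_complexity_eq_graver_complexity:
  "groebner_complexity TYPE('k::field) (ones_row n) B = graver_complexity TYPE('k) (ones_row n) B"
proof (rule antisym)
  show "groebner_complexity TYPE('k) (ones_row n) B \<le> graver_complexity TYPE('k) (ones_row n) B"
    unfolding groebner_complexity_def graver_complexity_def max_type_def
    using UGB_subset_graver[where 'k='k] by (intro Sup_subset_mono) blast
  show "graver_complexity TYPE('k) (ones_row n) B \<le> groebner_complexity TYPE('k) (ones_row n) B"
    unfolding graver_complexity_def max_type_def
  proof (rule Sup_least)
    fix x assume "x \<in> {enat (block_type (dim_col (ones_row n)) N u) |N u. 1 \<le> N \<and>
      u \<in> carrier_vec (N * dim_col (ones_row n)) \<and> (binom u :: 'k mpoly) \<in> graver (nfold (ones_row n) B N)}"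
    then obtain N u where x: "x = enat (block_type n N u)" "1 \<le> N"
        and u: "u \<in> carrier_vec (N * n)" "(binom u :: 'k mpoly) \<in> graver (nfold (ones_row n) B N)"
      by auto
    have "primitive_vec (nfold (ones_row n) B N) u"
      using u binom_in_graver_iff[of u "nfold (ones_row n) B N", where 'k='k] by simp
    then obtain N' v where v: "N' \<ge> N" "v \<in> carrier_vec (N' * n)" "block_type n N u \<le> block_type n N' v"
        "(binom v :: 'k mpoly) \<in> UGB (nfold (ones_row n) B N')"
      using UGB_of_larger_type[where 'k='k] by blast
    have "x \<le> enat (block_type n N' v)"
      using x v(3) by simp
    also have "\<dots> \<le> groebner_complexity TYPE('k) (ones_row n) B"
      unfolding groebner_complexity_def max_type_def
      using v x(2) by (intro Sup_upper CollectI exI[of _ N'] exI[of _ v]) simp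
    finally show "x \<le> groebner_complexity TYPE('k) (ones_row n) B" .
  qed
qed

end

text \<open>For the row of ones itself, a primitive vector has a positive and a negative entry, hence is the
  difference of the corresponding unit vectors.\<close>

lemma up_to_sign_UGB_ones_row:
  "up_to_sign (UGB (ones_row n) :: 'k::field mpoly set) = up_to_sign (graver (ones_row n))"
proof
  show "up_to_sign (UGB (ones_row n) :: 'k mpoly set) \<subseteq> up_to_sign (graver (ones_row n))"
    using UGB_subset_graver[where 'k='k] unfolding up_to_sign_def by blast
  have ker: "u \<in> mat_kernel (ones_row n) \<longleftrightarrow> u \<in> carrier_vec n \<and> (\<Sum>k<n. u $ k) = 0" for u
    by (simp add: mat_kernel_iff) (simp add: ones_row_def)
  have "(binom u :: 'k mpoly) \<in> UGB (ones_row n) \<or> binom (- u) \<in> (UGB (ones_row n) :: 'k mpoly set)"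
    if prim: "primitive_vec (ones_row n) u" for u
  proof (rule primitive_vec_UGB[OF prim])
    have u: "u \<in> carrier_vec n" "(\<Sum>k<n. u $ k) = 0" "u \<noteq> 0\<^sub>v n"
      using prim by (auto simp: primitive_vec_def ker)
    have "\<exists>p<n. u $ p > 0"
    proof (rule ccontr)
      assume "\<not> ?thesis"
      then have "\<forall>k\<in>{..<n}. u $ k = 0"
        using u(2) sum_nonneg_eq_0_iff[of "{..<n}" "\<lambda>k. - u $ k"] by (force simp: sum_negf)
      then show False using u(1,3) by (auto intro!: eq_vecI)
    qed
    then obtain p where p: "p < n" "u $ p > 0" by blast
    have "\<exists>q<n. u $ q < 0"
    proof (rule ccontr)
      assume "\<not> ?thesis"
      then have "\<forall>k\<in>{..<n}. u $ k = 0"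
        using u(2) sum_nonneg_eq_0_iff[of "{..<n}" "\<lambda>k. u $ k"] by force
      then show False using p by auto
    qed
    then obtain q where q: "q < n" "u $ q < 0" by blast
    define d where "d = vec n (\<lambda>k. of_bool (k = p) - of_bool (k = q) :: int)"
    have dk: "d $ k = (if k = p then 1 else 0) - (if k = q then 1 else 0)" if "k < n" for k
      using that by (simp add: d_def)
    have "d \<in> mat_kernel (ones_row n)"
      using p(1) q(1) unfolding ker by (simp add: dk sum_subtractf) (simp add: d_def)
    moreover have "conformal d u"
      using p q u(1) by (auto simp: conformal_def dk)
    moreover have "d \<noteq> 0\<^sub>v n"
    proof -
      have "p \<noteq> q" using p q by auto
      then have "d $ p = 1" using dk[OF p(1)] by simp
      then show ?thesis using p(1) by auto
    qed
    ultimately have ud: "u = d"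
      using prim by (auto simp: primitive_vec_def)
    fix w i
    assume fib: "same_fibre (ones_row n) w (pos_mono u)"
      and supp: "\<And>j. j < dim_col (ones_row n) \<Longrightarrow> u $ j = 0 \<Longrightarrow> Poly_Mapping.lookup w j = 0"
      and i: "i < dim_col (ones_row n)"
    have "exp_diff n w (pos_mono u) \<in> mat_kernel (ones_row n)"
      using fib by (simp add: same_fibre_iff_kernel)
    then have "(\<Sum>k<n. int (Poly_Mapping.lookup w k)) = (\<Sum>k<n. int (Poly_Mapping.lookup (pos_mono u) k))"
      by (simp add: ker sum_subtractf)
    also have "\<dots> = (\<Sum>k<n. if k = p then 1 else 0)"
      using u(1) p q by (intro sum.cong) (auto simp: lookup_pos_mono ud dk)
    also have "\<dots> = 1" using p(1) by simp
    finally have "(\<Sum>k<n. int (Poly_Mapping.lookup w k)) = 1" .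
    moreover have "int (Poly_Mapping.lookup w i) \<le> (\<Sum>k<n. int (Poly_Mapping.lookup w k))"
      using i by (intro member_le_sum) auto
    ultimately have "int (Poly_Mapping.lookup w i) \<le> 1" by simp
    then show "int (Poly_Mapping.lookup w i) \<le> \<bar>u $ i\<bar>"
      using supp[OF i] by (cases "u $ i = 0") auto
  qed
  then have "graver (ones_row n) \<subseteq> (up_to_sign (UGB (ones_row n)) :: 'k mpoly set)"
    unfolding graver_eq up_to_sign_def by (force simp: binom_uminus)
  then show "up_to_sign (graver (ones_row n)) \<subseteq> up_to_sign (UGB (ones_row n) :: 'k mpoly set)"
    by (auto simp: up_to_sign_def)
qed


section \<open>A primitive vector that is not an edge\<close>

text \<open>Column \<open>6 b + j\<close> carries the unit vector \<open>e\<^bsub>j+1\<^esub>\<close> of block \<open>b\<close>.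
  In the first two blocks, \<open>u\<^sup>+ = (e\<^sub>1 + e\<^sub>6, e\<^sub>1 + e\<^sub>6)\<close> and \<open>u\<^sup>- = (e\<^sub>2 + e\<^sub>4, 2 e\<^sub>4)\<close>. The fibre of
  \<open>u\<^sup>+\<close> also contains \<open>(2 e\<^sub>1, 2 e\<^sub>6)\<close> and \<open>(2 e\<^sub>6, 2 e\<^sub>1)\<close>, whose midpoint is \<open>u\<^sup>+\<close>.\<close>

definition example_entry :: "nat \<Rightarrow> int" where
  "example_entry k =
     (if k \<in> {0, 5, 6, 11} then 1 else if k \<in> {1, 3} then - 1 else if k = 9 then - 2 else 0)"

definition example_vec :: "nat \<Rightarrow> int vec" where
  "example_vec N = vec (N * 6) example_entry"

definition weight_row :: "int mat" where
  "weight_row = mat_of_rows_list 6 [[1, 2, 3, 4, 5, 6]]"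

lemma dim_weight_row [simp]: "dim_row weight_row = 1" "dim_col weight_row = 6"
  by (simp_all add: weight_row_def mat_of_rows_list_def)

lemma weight_row_entry: "j < 6 \<Longrightarrow> weight_row $$ (0, j) = int j + 1"
  by (auto simp: weight_row_def mat_of_rows_list_def less_Suc_eq numeral_eq_Suc)

lemma ones_row_6: "mat_of_rows_list 6 [[1, 1, 1, 1, 1, 1]] = ones_row 6"
  by (rule eq_matI) (auto simp: ones_row_def mat_of_rows_list_def less_Suc_eq numeral_eq_Suc)

lemma sum_first_blocks:
  fixes f :: "nat \<Rightarrow> int"
  assumes "1 < N" "\<And>k. 12 \<le> k \<Longrightarrow> k < N * 6 \<Longrightarrow> f k = 0"
  shows "(\<Sum>k<N * 6. f k) = f 0 + f 1 + f 2 + f 3 + f 4 + f 5 + f 6 + f 7 + f 8 + f 9 + f 10 + f 11"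
proof -
  have "(\<Sum>k<N * 6. f k) = (\<Sum>k<12. f k)"
    using assms by (intro sum.mono_neutral_right) auto
  then show ?thesis
    by (simp add: eval_nat_numeral)
qed

lemma kernel_first_blocks:
  assumes N: "1 < N" and v: "v \<in> carrier_vec (N * 6)"
    and z: "\<And>k. 12 \<le> k \<Longrightarrow> k < N * 6 \<Longrightarrow> v $ k = 0"
  shows "v \<in> mat_kernel (nfold (ones_row 6) weight_row N) \<longleftrightarrow>
    v $ 0 + v $ 1 + v $ 2 + v $ 3 + v $ 4 + v $ 5 = 0 \<and>
    v $ 6 + v $ 7 + v $ 8 + v $ 9 + v $ 10 + v $ 11 = 0 \<and>
    v $ 0 + 2 * v $ 1 + 3 * v $ 2 + 4 * v $ 3 + 5 * v $ 4 + 6 * v $ 5 +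
    v $ 6 + 2 * v $ 7 + 3 * v $ 8 + 4 * v $ 9 + 5 * v $ 10 + 6 * v $ 11 = 0"
proof -
  have "(\<Sum>k<N * 6. weight_row $$ (0, k mod 6) * v $ k) =
    v $ 0 + 2 * v $ 1 + 3 * v $ 2 + 4 * v $ 3 + 5 * v $ 4 + 6 * v $ 5 +
    v $ 6 + 2 * v $ 7 + 3 * v $ 8 + 4 * v $ 9 + 5 * v $ 10 + 6 * v $ 11"
    using z by (subst sum_first_blocks[OF N]) (simp_all add: weight_row_entry)
  moreover have "(\<Sum>k<N * 6. of_bool (k div 6 = b) * v $ k) =
    (if b = 0 then v $ 0 + v $ 1 + v $ 2 + v $ 3 + v $ 4 + v $ 5
     else if b = 1 then v $ 6 + v $ 7 + v $ 8 + v $ 9 + v $ 10 + v $ 11 else 0)" for b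
    using z by (subst sum_first_blocks[OF N]) simp_all
  moreover have "(\<forall>b<N. (if b = 0 then x else if b = 1 then y else 0) = (0 :: int)) \<longleftrightarrow> x = 0 \<and> y = 0"
    for x y
    using N by (auto dest: spec[of _ 0] spec[of _ 1])
  ultimately show ?thesis
    unfolding kernel_nfold_iff[of 6, simplified] using v by auto
qed

lemma example_vec_index: "k < N * 6 \<Longrightarrow> example_vec N $ k = example_entry k"
  by (simp add: example_vec_def)

lemma example_vec_carrier: "example_vec N \<in> carrier_vec (N * 6)"
  by (simp add: example_vec_def)

text \<open>The nonzero coordinates of a vector conformal to the example, in the first block \<open>(a, e, f, b)\<close>
  at positions 1, 2, 4, 6 and in the second block \<open>(c, g, d)\<close> at positions 1, 4, 6.\<close>

lemma example_solutions:
  fixes a b c d e f g :: int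
  assumes "0 \<le> a" "a \<le> 1" "0 \<le> b" "b \<le> 1" "0 \<le> c" "c \<le> 1" "0 \<le> d" "d \<le> 1"
    and "- 1 \<le> e" "e \<le> 0" "- 1 \<le> f" "f \<le> 0"
    and eqs: "a + e + f + b = 0" "c + g + d = 0" "a + 2 * e + 4 * f + 6 * b + c + 4 * g + 6 * d = 0"
  shows "(a = 0 \<and> b = 0 \<and> c = 0 \<and> d = 0 \<and> e = 0 \<and> f = 0 \<and> g = 0) \<or>
    (a = 1 \<and> b = 1 \<and> c = 1 \<and> d = 1 \<and> e = - 1 \<and> f = - 1 \<and> g = - 2)"
proof -
  have eg: "e = - a - b - f" "g = - c - d"
    using eqs(1,2) by linarith+
  have key: "4 * b + 2 * f + 2 * d = a + 3 * c" and e: "a + b + f \<le> 1" "0 \<le> a + b + f"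
    using eqs assms(9,10) by linarith+
  have "a = 0 \<or> a = 1" "b = 0 \<or> b = 1" "c = 0 \<or> c = 1" "d = 0 \<or> d = 1" "f = - 1 \<or> f = 0"
    using assms(1-8,11,12) by linarith+
  then have "a = 0 \<and> b = 0 \<and> c = 0 \<and> d = 0 \<and> f = 0 \<or> a = 1 \<and> b = 1 \<and> c = 1 \<and> d = 1 \<and> f = - 1"
    using key e by (elim disjE; simp)
  then show ?thesis
    unfolding eg by auto
qed

lemma primitive_example_vec:
  assumes N: "1 < N"
  shows "primitive_vec (nfold (ones_row 6) weight_row N) (example_vec N)"
proof -
  let ?M = "nfold (ones_row 6) weight_row N" and ?u = "example_vec N"
  have less: "k < N * 6" if "k < 12" for k using N that by linarith
  have ker: "?u \<in> mat_kernel ?M"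
    by (subst kernel_first_blocks[OF N example_vec_carrier])
       (use N in \<open>simp_all add: less example_vec_index example_entry_def\<close>)
  have nz: "?u \<noteq> 0\<^sub>v (N * 6)"
  proof
    assume "?u = 0\<^sub>v (N * 6)"
    then have "?u $ 0 = 0\<^sub>v (N * 6) $ 0" by (simp only:)
    then show False
      using N by (simp add: example_vec_index example_entry_def)
  qed
  have "v = 0\<^sub>v (N * 6) \<or> v = ?u" if v: "v \<in> mat_kernel ?M" "conformal v ?u" for v
  proof -
    have vdim: "v \<in> carrier_vec (N * 6)"
      using mat_kernel_dim[OF v(1)] by simp
    have conf: "0 \<le> v $ k \<and> v $ k \<le> example_entry k \<or> example_entry k \<le> v $ k \<and> v $ k \<le> 0"
      if "k < N * 6" for k
      using v(2) that by (auto simp: conformal_def example_vec_def)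
    have pos: "0 \<le> v $ k \<and> v $ k \<le> example_entry k" if "k < N * 6" "0 \<le> example_entry k" for k
      using conf[OF that(1)] that(2) by linarith
    have neg: "example_entry k \<le> v $ k \<and> v $ k \<le> 0" if "k < N * 6" "example_entry k \<le> 0" for k
      using conf[OF that(1)] that(2) by linarith
    have z: "v $ k = 0" if "k < N * 6" "example_entry k = 0" for k
      using conf[OF that(1)] that(2) by auto
    have far: "example_entry k = 0" if "12 \<le> k" for k
      using that by (simp add: example_entry_def)
    have "v $ k = 0" if "12 \<le> k" "k < N * 6" for k
      using z[OF that(2) far[OF that(1)]] .
    note eqs = iffD1[OF kernel_first_blocks[OF N vdim this] v(1)]
    have zs: "v $ 2 = 0" "v $ 4 = 0" "v $ 7 = 0" "v $ 8 = 0" "v $ 10 = 0"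
      by (simp_all add: z less example_entry_def)
    have bounds: "0 \<le> v $ 0" "v $ 0 \<le> 1" "0 \<le> v $ 5" "v $ 5 \<le> 1" "0 \<le> v $ 6" "v $ 6 \<le> 1"
      "0 \<le> v $ 11" "v $ 11 \<le> 1" "- 1 \<le> v $ 1" "v $ 1 \<le> 0" "- 1 \<le> v $ 3" "v $ 3 \<le> 0"
      "- 2 \<le> v $ 9" "v $ 9 \<le> 0"
      using pos[of 0] pos[of 5] pos[of 6] pos[of 11] neg[of 1] neg[of 3] neg[of 9] N
      by (simp_all add: less example_entry_def)
    have sol: "(v $ 0 = 0 \<and> v $ 5 = 0 \<and> v $ 6 = 0 \<and> v $ 11 = 0 \<and> v $ 1 = 0 \<and> v $ 3 = 0 \<and> v $ 9 = 0) \<or>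
      (v $ 0 = 1 \<and> v $ 5 = 1 \<and> v $ 6 = 1 \<and> v $ 11 = 1 \<and> v $ 1 = - 1 \<and> v $ 3 = - 1 \<and> v $ 9 = - 2)"
      using example_solutions[of "v $ 0" "v $ 5" "v $ 6" "v $ 11" "v $ 1" "v $ 3" "v $ 9"] eqs zs bounds
      by simp
    have cases: "k \<in> {0, 5, 6, 11, 1, 3, 9} \<or> example_entry k = 0" for k
      by (simp add: example_entry_def)
    from sol show ?thesis
    proof
      assume *: "v $ 0 = 0 \<and> v $ 5 = 0 \<and> v $ 6 = 0 \<and> v $ 11 = 0 \<and> v $ 1 = 0 \<and> v $ 3 = 0 \<and> v $ 9 = 0"
      have "v $ k = 0" if "k < N * 6" for k
        using cases[of k] * z[OF that] by auto
      then have "v = 0\<^sub>v (N * 6)"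
        using vdim by (intro eq_vecI) auto
      then show ?thesis ..
    next
      assume *: "v $ 0 = 1 \<and> v $ 5 = 1 \<and> v $ 6 = 1 \<and> v $ 11 = 1 \<and> v $ 1 = - 1 \<and> v $ 3 = - 1 \<and> v $ 9 = - 2"
      have "v $ k = ?u $ k" if "k < N * 6" for k
        using cases[of k] * z[OF that] that by (auto simp: example_vec_index example_entry_def)
      then have "v = ?u"
        using vdim by (intro eq_vecI) (auto simp: example_vec_def)
      then show ?thesis ..
    qed
  qed
  with ker nz show ?thesis
    by (simp add: primitive_vec_def)
qed

lemma example_vec_not_UGB:
  assumes N: "1 < N"
  shows "(binom (example_vec N) :: 'k::field mpoly) \<notin> up_to_sign (UGB (nfold (ones_row 6) weight_row N))"
proof -
  let ?M = "nfold (ones_row 6) weight_row N" and ?u = "example_vec N"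
  let ?a = "Poly_Mapping.single :: nat \<Rightarrow> nat \<Rightarrow> mono"
  define w1 where "w1 = ?a 0 2 + ?a 11 2"
  define w2 where "w2 = ?a 5 2 + ?a 6 2"
  have less: "k < N * 6" if "k < 12" for k using N that by linarith
  have w: "Poly_Mapping.lookup w1 k = (if k \<in> {0, 11} then 2 else 0)"
    "Poly_Mapping.lookup w2 k = (if k \<in> {5, 6} then 2 else 0)" for k
    by (auto simp: w1_def w2_def lookup_add lookup_single when_def simp del: single_numeral)
  have a: "Poly_Mapping.lookup (pos_mono ?u) k = (if k \<in> {0, 5, 6, 11} then 1 else 0)" for k
    using N by (auto simp: lookup_pos_mono example_vec_def example_entry_def)
  have mon: "w1 \<in> monomials (N * 6)" "w2 \<in> monomials (N * 6)" "pos_mono ?u \<in> monomials (N * 6)"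
    using N by (auto simp: monomials_def in_keys_iff w a split: if_splits)
  have "exp_diff (N * 6) w1 (pos_mono ?u) \<in> mat_kernel ?M"
    "exp_diff (N * 6) w2 (pos_mono ?u) \<in> mat_kernel ?M"
    using N by (subst kernel_first_blocks[OF N]; simp add: less w a)+
  then have fib: "same_fibre ?M w1 (pos_mono ?u)" "same_fibre ?M w2 (pos_mono ?u)"
    using mon by (simp_all add: same_fibre_iff_kernel)
  have "w1 + w2 = pos_mono ?u + pos_mono ?u"
    by (rule poly_mapping_eqI) (auto simp: lookup_add w a)
  moreover have "Poly_Mapping.lookup w1 0 \<noteq> Poly_Mapping.lookup (pos_mono ?u) 0"
    "Poly_Mapping.lookup w1 0 \<noteq> 0" "Poly_Mapping.lookup w2 5 \<noteq> 0"
    by (simp_all add: w a)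
  then have "w1 \<noteq> pos_mono ?u" "w1 \<noteq> 0" "w2 \<noteq> 0"
    by (metis, metis lookup_zero, metis lookup_zero)
  moreover have "?u \<in> carrier_vec (dim_col ?M)" "?u \<noteq> 0\<^sub>v (dim_col ?M)"
    using primitive_example_vec[OF N] example_vec_carrier by (auto simp: primitive_vec_def)
  ultimately show ?thesis
    using fib by (intro not_UGB_midpoint[of ?M w1 ?u w2])
qed

lemma UGB_strict_subset_graver:
  assumes "1 < N"
  shows "up_to_sign (UGB (nfold (ones_row 6) weight_row N) :: 'k::field mpoly set)
    \<subset> up_to_sign (graver (nfold (ones_row 6) weight_row N))"
proof -
  have "(binom (example_vec N) :: 'k mpoly) \<in> up_to_sign (graver (nfold (ones_row 6) weight_row N))"
    using primitive_example_vec[OF assms] by (auto simp: up_to_sign_def graver_eq)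
  then show ?thesis
    using example_vec_not_UGB[OF assms, where 'k='k] UGB_subset_graver[where 'k='k]
    unfolding up_to_sign_def by blast
qed

theorem mainTheorem2:
  shows "(\<exists>A B :: int mat.
            dim_col A = dim_col B \<and>
            up_to_sign (UGB A :: 'k::field mpoly set) = up_to_sign (graver A) \<and>
            groebner_complexity TYPE('k) A B = graver_complexity TYPE('k) A B \<and>
            (\<forall>N>1. up_to_sign (UGB (nfold A B N) :: 'k mpoly set)
                      \<subset> up_to_sign (graver (nfold A B N)))) \<and>
         (let A = mat_of_rows_list 6 [[1, 1, 1, 1, 1, 1]];
              B = mat_of_rows_list 6 [[1, 2, 3, 4, 5, 6]]
          in up_to_sign (UGB A :: 'k mpoly set) = up_to_sign (graver A) \<and>
             groebner_complexity TYPE('k) A B = graver_complexity TYPE('k) A B \<and>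
             (\<forall>N>1. up_to_sign (UGB (nfold A B N) :: 'k mpoly set)
                       \<subset> up_to_sign (graver (nfold A B N))))"
proof -
  have "up_to_sign (UGB (ones_row 6) :: 'k mpoly set) = up_to_sign (graver (ones_row 6)) \<and>
    groebner_complexity TYPE('k) (ones_row 6) weight_row = graver_complexity TYPE('k) (ones_row 6) weight_row \<and>
    (\<forall>N>1. up_to_sign (UGB (nfold (ones_row 6) weight_row N) :: 'k mpoly set)
              \<subset> up_to_sign (graver (nfold (ones_row 6) weight_row N)))"
    using up_to_sign_UGB_ones_row[of 6, where 'k='k]
      groebner_complexity_eq_graver_complexity[of 6 weight_row, where 'k='k]
      UGB_strict_subset_graver[where 'k='k]
    by (intro conjI allI impI) simp_all
  moreover have "dim_col (ones_row 6) = dim_col weight_row" by simp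
  ultimately show ?thesis
    unfolding Let_def ones_row_6 weight_row_def[symmetric] by blast
qed

end
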